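(* Let $-d=d_Kf^2\equiv1\pmod 3$ be a negative discriminant, $K=\mathbb{Q}(\sqrt{-d})$, $(3)=\wp_3\wp_3'$, and suppose the Artin symbol $\tau_3=\left(\frac{\Sigma_{\wp_3'^2}\Omega_f/K}{\wp_3}\right)$ has order $n\ge2$ in $\mathrm{Gal}(\Sigma_{\wp_3'^2}\Omega_f/K)$. Then $n$ is the smallest positive integer for which $$\wp_3^n=\left(\frac{x+y\sqrt{-d}}{2}\right),\quad \frac{x+y\sqrt{-d}}{2}\in\mathsf{R}_{-d},\quad x\equiv\pm1\pmod 9,$$ with $\alpha=\frac{x+y\sqrt{-d}}{2}\equiv\pm1\pmod{\wp_3'^2}$.
   Context: $d_K$ is the discriminant of $K$, $\mathsf{R}_{-d}$ the order of discriminant $-d$ (conductor $f$) in the ring of integers of $K$, $x,y\in\mathbb{Z}$; $(3)=\wp_3\wp_3'$ is the factorization of $3$ into conjugate prime ideals of $K$. $\Omega_f$ is the ring class field of $K$ of conductor $f$, $\Sigma_{\wp_3'^2}$ the ray class field of $K$ of conductor $\wp_3'^2$. (The order $n$ of $\tau_3$ equals the minimal period of the corresponding periodic points of the algebraic function defined by $w^3+(-z^3+6z^2-6z-1)w^2+(z^3-3z^2+3z+1)w-z^3=0$.) *)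

theory Defs
  imports
    "HOL-Algebra.Algebra"
    "HOL-Algebra.Algebraic_Closure_Type"
    "HOL-Number_Theory.Cong"
    Complex_Main
begin

text \<open>All number fields are subfields of the complex numbers.\<close>

abbreviation CC :: "complex ring"
  where "CC \<equiv> ring_of_type_algebra"

definition ring_of_ints :: "complex set \<Rightarrow> complex ring"
  where "ring_of_ints K = CC\<lparr>carrier := {x \<in> K. algebraic_int x}\<rparr>"

definition nonzero_primes :: "complex set \<Rightarrow> complex set set"
  where "nonzero_primes K = {p. primeideal p (ring_of_ints K) \<and> p \<noteq> {0}}"

definition ideal_norm :: "complex set \<Rightarrow> complex set \<Rightarrow> nat"
  where "ideal_norm K I = card (carrier (ring_of_ints K Quot I))"

definition comaximal :: "complex set \<Rightarrow> complex set \<Rightarrow> complex set \<Rightarrow> bool"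
  where "comaximal K I J \<longleftrightarrow> I <+>\<^bsub>ring_of_ints K\<^esub> J = carrier (ring_of_ints K)"

definition quadratic_field :: "int \<Rightarrow> complex set"
  where "quadratic_field D = generate_field CC {csqrt (of_int D)}"

text \<open>
  For an imaginary quadratic field \<open>K\<close> the two embeddings into the complex numbers are the
  inclusion and complex conjugation, so this is \<open>(det (\<sigma>\<^sub>i \<omega>\<^sub>j))\<^sup>2\<close> for an integral basis
  \<open>\<omega>\<^sub>1, \<omega>\<^sub>2\<close>.
\<close>
definition imag_quadratic_disc :: "complex set \<Rightarrow> int \<Rightarrow> bool"
  where "imag_quadratic_disc K D \<longleftrightarrow>
    (\<exists>w1 w2. bij_betw (\<lambda>(a :: int, b :: int). of_int a * w1 + of_int b * w2)
                UNIV (carrier (ring_of_ints K)) \<and>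
             of_int D = (w1 * cnj w2 - w2 * cnj w1)\<^sup>2)"

definition quadratic_order :: "complex set \<Rightarrow> nat \<Rightarrow> complex set"
  where "quadratic_order K f =
    {of_int a + of_nat f * w | a w. w \<in> carrier (ring_of_ints K)}"


subsection \<open>Galois groups and Artin symbols\<close>

definition Gal :: "complex set \<Rightarrow> complex set \<Rightarrow> (complex \<Rightarrow> complex) monoid"
  where "Gal K L = (BijGroup L)\<lparr>carrier :=
    {\<sigma> \<in> Bij L. \<sigma> \<in> ring_hom (CC\<lparr>carrier := L\<rparr>) (CC\<lparr>carrier := L\<rparr>) \<and> (\<forall>x\<in>K. \<sigma> x = x)}\<rparr>"

definition galois_extension :: "complex set \<Rightarrow> complex set \<Rightarrow> bool"
  where "galois_extension K L \<longleftrightarrow>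
    subfield K CC \<and> subfield L CC \<and> K \<subseteq> L \<and> ring.finite_dimension CC K L \<and>
    {x \<in> L. \<forall>\<sigma>\<in>carrier (Gal K L). \<sigma> x = x} = K"

definition abelian_extension :: "complex set \<Rightarrow> complex set \<Rightarrow> bool"
  where "abelian_extension K L \<longleftrightarrow> galois_extension K L \<and> comm_group (Gal K L)"

definition compositum :: "complex set \<Rightarrow> complex set \<Rightarrow> complex set"
  where "compositum L M = generate_field CC (L \<union> M)"

definition primes_above :: "complex set \<Rightarrow> complex set \<Rightarrow> complex set \<Rightarrow> complex set set"
  where "primes_above K L p = {P \<in> nonzero_primes L. P \<inter> K = p}"

definition ramification_index :: "complex set \<Rightarrow> complex set \<Rightarrow> complex set \<Rightarrow> nat"
  where "ramification_index L p P =
    (GREATEST e. genideal (ring_of_ints L) p \<subseteq> P [^]\<^bsub>ideals_set (ring_of_ints L)\<^esub> e)"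

definition unramified :: "complex set \<Rightarrow> complex set \<Rightarrow> complex set \<Rightarrow> bool"
  where "unramified K L p \<longleftrightarrow> (\<forall>P\<in>primes_above K L p. ramification_index L p P = 1)"

definition frobenius_at ::
    "complex set \<Rightarrow> complex set \<Rightarrow> complex set \<Rightarrow> complex set \<Rightarrow> (complex \<Rightarrow> complex) \<Rightarrow> bool"
  where "frobenius_at K L p P \<sigma> \<longleftrightarrow>
    \<sigma> \<in> carrier (Gal K L) \<and> (\<forall>a\<in>carrier (ring_of_ints L). \<sigma> a - a ^ ideal_norm K p \<in> P)"

text \<open>
  \<open>is_artin_symbol K L p \<sigma>\<close> says that \<open>\<sigma>\<close> is the Artin symbol of \<open>p\<close> in the abelian extension
  \<open>L\<close> of \<open>K\<close>: for each prime \<open>P\<close> of \<open>L\<close> above \<open>p\<close>, it is the unique element of the Galois group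
  with \<open>\<sigma> a \<equiv> a ^ N(p)\<close> modulo \<open>P\<close> for all integers \<open>a\<close> of \<open>L\<close>.
\<close>
definition is_artin_symbol ::
    "complex set \<Rightarrow> complex set \<Rightarrow> complex set \<Rightarrow> (complex \<Rightarrow> complex) \<Rightarrow> bool"
  where "is_artin_symbol K L p \<sigma> \<longleftrightarrow>
    \<sigma> \<in> carrier (Gal K L) \<and>
    (\<forall>P\<in>primes_above K L p. \<forall>\<rho>. frobenius_at K L p P \<rho> \<longleftrightarrow> \<rho> = \<sigma>)"


subsection \<open>Class fields\<close>

definition fractional_ideal :: "complex set \<Rightarrow> complex set \<Rightarrow> bool"
  where "fractional_ideal K I \<longleftrightarrow>
    I \<subseteq> K \<and> I \<noteq> {0} \<and>
    (\<exists>c\<in>carrier (ring_of_ints K). c \<noteq> 0 \<and> ideal ((\<lambda>x. c * x) ` I) (ring_of_ints K))"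

text \<open>
  The group of fractional ideals prime to the integral ideal \<open>m\<close>, that is, of the quotients of
  nonzero integral ideals prime to \<open>m\<close>.
\<close>
definition ideal_group :: "complex set \<Rightarrow> complex set \<Rightarrow> complex set monoid"
  where "ideal_group K m =
    \<lparr>carrier = {I. fractional_ideal K I \<and>
       (\<exists>A B. ideal A (ring_of_ints K) \<and> A \<noteq> {0} \<and> comaximal K A m \<and>
              ideal B (ring_of_ints K) \<and> B \<noteq> {0} \<and> comaximal K B m \<and>
              ideal_prod CC I B = A)},
     monoid.mult = ideal_prod CC,
     one = carrier (ring_of_ints K)\<rparr>"

text \<open>
  \<open>class_field K m H L\<close>: \<open>L\<close> is the abelian extension of \<open>K\<close> unramified outside \<open>m\<close> for which
  the kernel of the Artin map on the fractional ideals prime to \<open>m\<close> is \<open>H\<close>. Archimedean primes are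
  ignored here and in \<open>ray_subgroup\<close>, so \<open>K\<close> is meant to be totally imaginary.
\<close>
definition class_field ::
    "complex set \<Rightarrow> complex set \<Rightarrow> complex set set \<Rightarrow> complex set \<Rightarrow> bool"
  where "class_field K m H L \<longleftrightarrow>
    abelian_extension K L \<and>
    (\<forall>p\<in>nonzero_primes K. \<not> unramified K L p \<longrightarrow> m \<subseteq> p) \<and>
    (\<exists>\<Phi>\<in>hom (ideal_group K m) (Gal K L).
       (\<forall>p\<in>nonzero_primes K. comaximal K p m \<longrightarrow> is_artin_symbol K L p (\<Phi> p)) \<and>
       kernel (ideal_group K m) (Gal K L) \<Phi> = H)"

definition ray_subgroup :: "complex set \<Rightarrow> complex set \<Rightarrow> complex set set"
  where "ray_subgroup K m = generate (ideal_group K m)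
    {cgenideal (ring_of_ints K) a | a. a \<in> carrier (ring_of_ints K) \<and> a \<noteq> 0 \<and> a - 1 \<in> m}"

definition ring_subgroup :: "complex set \<Rightarrow> nat \<Rightarrow> complex set set"
  where "ring_subgroup K f =
    generate (ideal_group K (cgenideal (ring_of_ints K) (of_nat f)))
      {cgenideal (ring_of_ints K) a | a. a \<in> carrier (ring_of_ints K) \<and> a \<noteq> 0 \<and>
         (\<exists>c :: int. coprime c (int f) \<and> a - of_int c \<in> cgenideal (ring_of_ints K) (of_nat f))}"

definition is_ray_class_field :: "complex set \<Rightarrow> complex set \<Rightarrow> complex set \<Rightarrow> bool"
  where "is_ray_class_field K m L \<longleftrightarrow> class_field K m (ray_subgroup K m) L"

definition is_ring_class_field :: "complex set \<Rightarrow> nat \<Rightarrow> complex set \<Rightarrow> bool"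
  where "is_ring_class_field K f L \<longleftrightarrow>
    class_field K (cgenideal (ring_of_ints K) (of_nat f)) (ring_subgroup K f) L"

end

theory Submission
  imports Defs "Jordan_Normal_Form.Char_Poly"
begin

text \<open>
  The restrictions of \<open>\<tau>\<close> to \<open>\<Sigma>\<close> and \<open>\<Omega>\<close> are the Artin symbols of \<open>p3\<close> there, so
  \<open>\<tau> ^ k = 1\<close> holds iff \<open>p3 ^ k\<close> lies in both the ray subgroup modulo \<open>p3'\<^sup>2\<close> and the ring
  subgroup modulo \<open>f\<close>. An integral ideal in the first is generated by some \<open>\<alpha> \<equiv> 1\<close> modulo
  \<open>p3'\<^sup>2\<close>, and \<open>p3 ^ k\<close> in the second by an element of the order of conductor \<open>f\<close>; the two generators
  agree up to sign because \<open>d\<^sub>K \<equiv> 1\<close> modulo 3 forces the units to be \<open>\<plusminus>1\<close>. Finally \<open>x\<close> is the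
  trace of \<open>\<alpha>\<close>, and for \<open>k \<ge> 2\<close> the conjugate of \<open>\<alpha>\<close> lies in \<open>p3'\<^sup>2\<close>, so \<open>x \<equiv> \<alpha> \<equiv> \<plusminus>1\<close>
  modulo \<open>p3'\<^sup>2\<close>, that is, modulo 9.
\<close>

subsection \<open>Algebraic integers form a ring\<close>

text \<open>The arithmetic uses that \<open>p\<close> and \<open>p'\<close> are conjugate, have
  product (3) and are comaximal; the last holds because -d is 1 modulo 3. These facts make an
  integer in the k-th power of \<open>p'\<close> divisible by \<open>3 ^ k\<close> and make
  \<open>p\<close> the only prime ideal containing \<open>p\<close>. As 3 does not divide f,
  \<open>p\<close> is also prime to both moduli. One obstacle shapes the middle of the proof:
  \<open>is_artin_symbol\<close> speaks only of primes above \<open>p\<close>, so it pins down no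
  automorphism until such a prime of the compositum is exhibited. It is a maximal ideal over the
  extension of \<open>p\<close>. That extension is proper: otherwise all of \<open>p'\<close> would
  be divisible by 3, and then 3 would lie in 3 times \<open>p\<close>. A second one is that Galois
  extensions are defined by their fixed field, so stability of \<Sigma> and \<Omega> under \<tau>
  has to come from orbit polynomials. The class subgroups are generated with inverses, hence consist
  of ideals (a/b). Integrality of the k-th power of \<open>p\<close> puts a/b into the ring of
  integers, and only then can the congruences for a and b be transferred to a/b.\<close>

text \<open>For finite \<open>B\<close> this is the subgroup generated by \<open>B\<close>. Over an
  infinite \<open>B\<close> the sum defaults to 0, so all uses below supply finite sets.\<close>

definition int_span :: "complex set \<Rightarrow> complex set"
  where "int_span B = {\<Sum>b\<in>B. of_int (c b) * b | c :: complex \<Rightarrow> int. True}"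

lemma int_span_superset:
  assumes "finite B" "x \<in> B"
  shows "x \<in> int_span B"
proof -
  have "(\<Sum>b\<in>B. of_int (if b = x then 1 else 0) * b) = (\<Sum>b\<in>B. if b = x then b else 0)"
    by (rule sum.cong) auto
  hence "x = (\<Sum>b\<in>B. of_int (if b = x then 1 else 0) * b)" using assms by simp
  thus ?thesis unfolding int_span_def by (blast intro: exI[of _ "\<lambda>b. if b = x then 1 else 0"])
qed

lemma int_span_add:
  assumes "x \<in> int_span B" "y \<in> int_span B"
  shows "x + y \<in> int_span B"
proof -
  from assms obtain c e :: "complex \<Rightarrow> int"
      where "x = (\<Sum>b\<in>B. of_int (c b) * b)" "y = (\<Sum>b\<in>B. of_int (e b) * b)"
    by (auto simp: int_span_def)
  hence "x + y = (\<Sum>b\<in>B. of_int (c b + e b) * b)"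
    by (simp add: sum.distrib algebra_simps)
  thus ?thesis unfolding int_span_def by (auto intro!: exI[of _ "\<lambda>b. c b + e b"])
qed

lemma int_span_mult_int:
  assumes "x \<in> int_span B"
  shows "of_int k * x \<in> int_span B"
proof -
  from assms obtain c :: "complex \<Rightarrow> int" where "x = (\<Sum>b\<in>B. of_int (c b) * b)"
    by (auto simp: int_span_def)
  hence "of_int k * x = (\<Sum>b\<in>B. of_int (k * c b) * b)"
    by (simp add: sum_distrib_left mult.assoc)
  thus ?thesis unfolding int_span_def by (auto intro!: exI[of _ "\<lambda>b. k * c b"])
qed

lemma int_span_zero: "0 \<in> int_span B"
  unfolding int_span_def by (auto intro!: exI[of _ "\<lambda>b. 0"])

lemma int_span_sum:
  assumes "\<And>i. i \<in> I \<Longrightarrow> g i \<in> int_span B"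
  shows "(\<Sum>i\<in>I. g i) \<in> int_span B"
  using assms
  by (induction I rule: infinite_finite_induct) (auto simp: int_span_zero int_span_add)

lemma int_span_mult_closed:
  assumes "\<And>b. b \<in> B \<Longrightarrow> x * b \<in> int_span B" "z \<in> int_span B"
  shows "x * z \<in> int_span B"
proof -
  from assms obtain c :: "complex \<Rightarrow> int" where "z = (\<Sum>b\<in>B. of_int (c b) * b)"
    by (auto simp: int_span_def)
  hence "x * z = (\<Sum>b\<in>B. of_int (c b) * (x * b))"
    by (simp add: sum_distrib_left algebra_simps)
  thus ?thesis using assms(1) by (auto intro!: int_span_sum int_span_mult_int)
qed

text \<open>The determinant trick: \<open>x\<close> is an eigenvalue of an integer matrix.\<close>
lemma algebraic_int_if_int_span_stable:
  assumes "finite B" "1 \<in> B" "\<And>b. b \<in> B \<Longrightarrow> x * b \<in> int_span B"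
  shows "algebraic_int x"
proof -
  obtain c :: "complex \<Rightarrow> complex \<Rightarrow> int"
      where c: "\<And>b. b \<in> B \<Longrightarrow> x * b = (\<Sum>e\<in>B. of_int (c b e) * e)"
    using assms(3) unfolding int_span_def by (simp add: Bex_def) metis
  define n where "n = card B"
  obtain h where h: "bij_betw h {0..<n} B"
    using ex_bij_betw_nat_finite[OF assms(1)] n_def by blast
  define A where "A = mat n n (\<lambda>(i,j). c (h i) (h j))"
  have A: "A \<in> carrier_mat n n" by (simp add: A_def)
  let ?M = "map_mat of_int A :: complex mat"
  define v where "v = vec n h"
  have M: "?M \<in> carrier_mat n n" using A by simp
  have "?M *\<^sub>v v = x \<cdot>\<^sub>v v"
  proof (rule eq_vecI)
    fix i assume "i < dim_vec (x \<cdot>\<^sub>v v)"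
    hence i: "i < n" by (simp add: v_def)
    have hi: "h i \<in> B" using h i by (auto dest: bij_betwE)
    have "vec_index (?M *\<^sub>v v) i = (\<Sum>j\<in>{0..<n}. of_int (c (h i) (h j)) * h j)"
      using i A by (simp add: scalar_prod_def v_def A_def)
    also have "\<dots> = (\<Sum>e\<in>B. of_int (c (h i) e) * e)"
      using sum.reindex_bij_betw[OF h] by auto
    also have "\<dots> = x * h i" using c[OF hi] by simp
    finally show "vec_index (?M *\<^sub>v v) i = vec_index (x \<cdot>\<^sub>v v) i"
        using i by (simp add: v_def)
  qed (use A in \<open>auto simp: v_def\<close>)
  \<comment> \<open>An eigenvector has to be nonzero; the hypothesis \<open>1 \<in> B\<close>
    provides an entry equal to 1.\<close>
  moreover have "v \<noteq> 0\<^sub>v n"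
  proof
    assume *: "v = 0\<^sub>v n"
    obtain i where "i < n" "h i = 1" using h assms(2) by (auto simp: bij_betw_def)
    thus False using * by (metis index_vec index_zero_vec(1) v_def zero_neq_one)
  qed
  ultimately have "eigenvector ?M v x" using M by (simp add: eigenvector_def v_def A_def)
  hence "poly (char_poly ?M) x = 0"
    using eigenvalue_root_char_poly[OF M] by (auto simp: eigenvalue_def)
  moreover have "char_poly ?M = map_poly of_int (char_poly A)"
    using of_int_hom.char_poly_hom[OF A] by simp
  moreover have "lead_coeff (char_poly ?M) = 1"
    using degree_monic_char_poly[OF M] by simp
  ultimately show ?thesis
    by (intro algebraic_int.intros[of "char_poly ?M"]) (auto simp: coeff_map_poly)
qed

text \<open>A monic integer equation of degree \<open>m\<close> expresses \<open>x ^ m\<close>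
  through lower powers. Positivity of \<open>m\<close> ensures that 1 is among those powers.\<close>

lemma algebraic_int_power_in_int_span:
  assumes "algebraic_int (x :: complex)"
  obtains m where "m > 0" "x ^ m \<in> int_span ((\<lambda>i. x ^ i) ` {..<m})"
proof -
  obtain p :: "int Polynomial.poly" where p: "poly (map_poly of_int p) x = 0" "lead_coeff p = 1"
    using assms unfolding algebraic_int_altdef_ipoly by blast
  define m where "m = Polynomial.degree p"
  let ?B = "(\<lambda>i. x ^ i) ` {..<m}"
  have "poly (map_poly of_int p) x = (\<Sum>i\<le>m. of_int (Polynomial.coeff p i) * x ^ i)"
    by (simp add: poly_altdef m_def coeff_map_poly)
  also have "\<dots> = (\<Sum>i<m. of_int (Polynomial.coeff p i) * x ^ i) + x ^ m"
    using p(2) by (simp add: lessThan_Suc_atMost[symmetric] m_def)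
  finally have *: "x ^ m = (\<Sum>i<m. of_int (- Polynomial.coeff p i) * x ^ i)"
    using p(1) by (simp add: sum_negf eq_neg_iff_add_eq_0 add.commute)
  have "x ^ m \<in> int_span ?B"
    unfolding * by (intro int_span_sum int_span_mult_int int_span_superset) auto
  \<comment> \<open>For \<open>m = 0\<close> the sum is empty and the relation would read 1 =
    0.\<close>
  moreover have "m > 0"
  proof (rule ccontr)
    assume "\<not> m > 0"
    with * show False by simp
  qed
  ultimately show ?thesis using that by blast
qed

text \<open>The monomials \<open>x ^ i * y ^ j\<close> with \<open>i < m\<close>,
  \<open>j < n\<close> span a module stable under \<open>x\<close> and \<open>y\<close>:
  multiplication leaves the box only at its edge, where the monic relation for \<open>x ^ m\<close>
  or \<open>y ^ n\<close> leads back. Such a module is then stable under \<open>x + y\<close> and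
  \<open>x * y\<close>, and the determinant trick applies.\<close>

lemma algebraic_int_add_times:
  assumes "algebraic_int (x :: complex)" "algebraic_int y"
  shows "algebraic_int (x + y) \<and> algebraic_int (x * y)"
proof -
  obtain m where m: "m > 0" "x ^ m \<in> int_span ((\<lambda>i. x ^ i) ` {..<m})"
    using algebraic_int_power_in_int_span[OF assms(1)] .
  obtain n where n: "n > 0" "y ^ n \<in> int_span ((\<lambda>i. y ^ i) ` {..<n})"
    using algebraic_int_power_in_int_span[OF assms(2)] .
  define B where "B = (\<lambda>(i, j). x ^ i * y ^ j) ` ({..<m} \<times> {..<n})"
  have fin: "finite B" by (simp add: B_def)
  have 1: "1 \<in> B" using m n by (force simp: B_def)
  have mem: "x ^ i * y ^ j \<in> int_span B" if "i < m" "j < n" for i j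
    using that by (intro int_span_superset[OF fin]) (auto simp: B_def)
  \<comment> \<open>Handles the edge of the box: \<open>w\<close> is a top power written in the
    powers \<open>C\<close> of one variable, and \<open>z\<close> is the accompanying power of the
    other.\<close>
  have shift: "z * w \<in> int_span B" if w: "w \<in> int_span C"
      and "\<And>u. u \<in> C \<Longrightarrow> z * u \<in> int_span B" for z w C
  proof -
    from w obtain c :: "complex \<Rightarrow> int" where "w = (\<Sum>b\<in>C. of_int (c b) * b)"
      by (auto simp: int_span_def)
    hence "z * w = (\<Sum>b\<in>C. of_int (c b) * (z * b))"
      by (simp add: sum_distrib_left algebra_simps)
    thus ?thesis using that(2) by (auto intro!: int_span_sum int_span_mult_int)
  qed
  have x: "x * b \<in> int_span B" if "b \<in> B" for b
  proof -
    from that obtain i j where ij: "b = x ^ i * y ^ j" "i < m" "j < n" by (auto simp: B_def)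
    show ?thesis
    proof (cases "Suc i < m")
      case True
      thus ?thesis using mem[of "Suc i" j] ij by (simp add: mult.assoc)
    next
      case False
      hence "Suc i = m" using ij by simp
      hence "x * b = y ^ j * x ^ m" using ij by (simp add: algebra_simps flip: power_Suc)
      moreover have "y ^ j * u \<in> int_span B" if "u \<in> (\<lambda>i. x ^ i) ` {..<m}" for u
        using that mem[OF _ ij(3)] by (auto simp: mult.commute)
      ultimately show ?thesis using shift[OF m(2), of "y ^ j"] by simp
    qed
  qed
  have y: "y * b \<in> int_span B" if "b \<in> B" for b
  proof -
    from that obtain i j where ij: "b = x ^ i * y ^ j" "i < m" "j < n" by (auto simp: B_def)
    show ?thesis
    proof (cases "Suc j < n")
      case True
      thus ?thesis using mem[of i "Suc j"] ij by (simp add: algebra_simps)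
    next
      case False
      hence "Suc j = n" using ij by simp
      hence "y * b = x ^ i * y ^ n" using ij by (simp add: algebra_simps flip: power_Suc)
      moreover have "x ^ i * u \<in> int_span B" if "u \<in> (\<lambda>i. y ^ i) ` {..<n}" for u
        using that mem[OF ij(2)] by auto
      ultimately show ?thesis using shift[OF n(2), of "x ^ i"] by simp
    qed
  qed
  have "algebraic_int (x + y)"
    using x y by (intro algebraic_int_if_int_span_stable[OF fin 1])
      (auto simp: distrib_right intro!: int_span_add)
  moreover have "algebraic_int (x * y)"
    using x y by (intro algebraic_int_if_int_span_stable[OF fin 1])
      (simp add: mult.assoc int_span_mult_closed)
  ultimately show ?thesis by blast
qed

lemmas algebraic_int_add = algebraic_int_add_times[THEN conjunct1]
lemmas algebraic_int_times = algebraic_int_add_times[THEN conjunct2]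

subsection \<open>Rings of integers and their ideals\<close>

lemma CC_simps [simp]:
  "carrier CC = UNIV" "x \<otimes>\<^bsub>CC\<^esub> y = x * y" "\<one>\<^bsub>CC\<^esub> = 1" "\<zero>\<^bsub>CC\<^esub> = 0" "x \<oplus>\<^bsub>CC\<^esub> y = x + y"
  by (simp_all add: ring_of_type_algebra_def)

lemma field_CC: "field CC"
  by (rule field_from_type_algebra)

lemma CC_a_inv [simp]: "\<ominus>\<^bsub>CC\<^esub> x = - x"
proof -
  interpret field CC by (rule field_CC)
  show ?thesis using minus_equality[of "- x" x] by simp
qed

lemma CC_m_inv [simp]: "x \<noteq> 0 \<Longrightarrow> inv\<^bsub>CC\<^esub> x = inverse x"
proof -
  assume "x \<noteq> 0"
  interpret field CC by (rule field_CC)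
  show ?thesis using comm_inv_char[of x "inverse x"] \<open>x \<noteq> 0\<close> by simp
qed

lemma subfield_CC_closed:
  assumes "subfield K CC"
  shows "0 \<in> K" "1 \<in> K" "x \<in> K \<Longrightarrow> y \<in> K \<Longrightarrow> x + y \<in> K" "x \<in> K \<Longrightarrow> - x \<in> K"
    "x \<in> K \<Longrightarrow> y \<in> K \<Longrightarrow> x * y \<in> K" "x \<in> K \<Longrightarrow> y \<in> K \<Longrightarrow> x - y \<in> K"
    "x \<in> K \<Longrightarrow> inverse x \<in> K" "x \<in> K \<Longrightarrow> y \<in> K \<Longrightarrow> x / y \<in> K"
    "of_int n \<in> K" "of_nat k \<in> K"
proof -
  have sr: "subring K CC" using assms by (rule subfieldE(1))
  show 0: "0 \<in> K" using subringE(2)[OF sr] by simp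
  show 1: "1 \<in> K" using subringE(3)[OF sr] by simp
  show add: "x \<in> K \<Longrightarrow> y \<in> K \<Longrightarrow> x + y \<in> K" for x y
      using subringE(7)[OF sr] by fastforce
  show neg: "x \<in> K \<Longrightarrow> - x \<in> K" for x using subringE(5)[OF sr] by fastforce
  show mult: "x \<in> K \<Longrightarrow> y \<in> K \<Longrightarrow> x * y \<in> K" for x y
      using subringE(6)[OF sr] by fastforce
  show "x \<in> K \<Longrightarrow> y \<in> K \<Longrightarrow> x - y \<in> K" for x y
      using add[of x "- y"] neg by simp
  show inv: "x \<in> K \<Longrightarrow> inverse x \<in> K" for x
  proof (cases "x = 0")
    case False
    assume "x \<in> K"
    thus ?thesis using ring.subfield_m_inv(1)[OF cring.axioms(1)[OF domain.axioms(1)[OF field.axioms(1)[OF field_CC]]] assms, of x] False by simp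
  qed (use 0 in auto)
  show "x \<in> K \<Longrightarrow> y \<in> K \<Longrightarrow> x / y \<in> K" for x y
      using mult[of x "inverse y"] inv by (simp add: field_simps)
  show nat: "of_nat k \<in> K" for k by (induction k) (auto simp: 0 1 add)
  show "of_int n \<in> K" by (cases n rule: int_cases2) (auto simp: nat neg)
qed

lemma subfield_CC_generate_field: "subfield (generate_field CC S) CC"
  using field.generate_field_is_subfield[OF field_CC] by simp

abbreviation (input) intring :: "complex set \<Rightarrow> complex set"
  where "intring K \<equiv> carrier (ring_of_ints K)"

lemma ring_of_ints_simps [simp]:
  "x \<otimes>\<^bsub>ring_of_ints K\<^esub> y = x * y" "\<one>\<^bsub>ring_of_ints K\<^esub> = 1" "\<zero>\<^bsub>ring_of_ints K\<^esub> = 0" "x \<oplus>\<^bsub>ring_of_ints K\<^esub> y = x + y"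
  by (simp_all add: ring_of_ints_def)

lemma mem_intring_iff: "x \<in> intring K \<longleftrightarrow> x \<in> K \<and> algebraic_int x"
  by (simp add: ring_of_ints_def)

lemma intring_closed:
  assumes "subfield K CC"
  shows "0 \<in> intring K" "1 \<in> intring K" "x \<in> intring K \<Longrightarrow> y \<in> intring K \<Longrightarrow> x + y \<in> intring K" "x \<in> intring K \<Longrightarrow> - x \<in> intring K"
    "x \<in> intring K \<Longrightarrow> y \<in> intring K \<Longrightarrow> x * y \<in> intring K" "x \<in> intring K \<Longrightarrow> y \<in> intring K \<Longrightarrow> x - y \<in> intring K"
    "of_int n \<in> intring K" "of_nat k \<in> intring K"
proof -
  show add: "x \<in> intring K \<Longrightarrow> y \<in> intring K \<Longrightarrow> x + y \<in> intring K" for x y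
    by (simp add: mem_intring_iff subfield_CC_closed[OF assms] algebraic_int_add)
  show neg: "x \<in> intring K \<Longrightarrow> - x \<in> intring K" for x
    by (simp add: mem_intring_iff subfield_CC_closed[OF assms])
  show "x \<in> intring K \<Longrightarrow> y \<in> intring K \<Longrightarrow> x - y \<in> intring K"
      using add[of x "- y"] neg by simp
qed (auto simp: mem_intring_iff subfield_CC_closed[OF assms] algebraic_int_times int_imp_algebraic_int)

lemma cring_ring_of_ints:
  assumes "subfield K CC"
  shows "cring (ring_of_ints K)"
proof (rule cringI)
  show "abelian_group (ring_of_ints K)"
  proof (rule abelian_groupI)
    show "\<exists>y\<in>intring K. y \<oplus>\<^bsub>ring_of_ints K\<^esub> x = \<zero>\<^bsub>ring_of_ints K\<^esub>" if "x \<in> intring K" for x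
      using intring_closed(4)[OF assms that] by (auto intro: bexI[of _ "- x"])
  qed (auto simp: intring_closed[OF assms])
  show "Group.comm_monoid (ring_of_ints K)"
    by (rule Group.comm_monoidI) (auto simp: intring_closed[OF assms])
qed (auto simp: algebra_simps)

lemma ideal_ring_of_intsI:
  assumes K: "subfield K CC"
      and "I \<subseteq> intring K" "0 \<in> I" "\<And>x y. x \<in> I \<Longrightarrow> y \<in> I \<Longrightarrow> x + y \<in> I"
    and mult: "\<And>r x. r \<in> intring K \<Longrightarrow> x \<in> I \<Longrightarrow> r * x \<in> I"
  shows "ideal I (ring_of_ints K)"
proof -
  interpret cring "ring_of_ints K" by (rule cring_ring_of_ints[OF K])
  have neg: "\<ominus>\<^bsub>ring_of_ints K\<^esub> x \<in> I" if "x \<in> I" for x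
  proof -
    have "- x \<in> I" using mult[of "-1" x] that intring_closed(4)[OF K intring_closed(2)[OF K]] by simp
    thus ?thesis using minus_equality[of "- x" x] subsetD[OF assms(2)] that by simp
  qed
  show ?thesis
  proof (rule idealI[OF ring_axioms])
    show "subgroup I (add_monoid (ring_of_ints K))"
      using assms neg unfolding subgroup_def a_inv_def by auto
  next
    fix a x assume "a \<in> I" "x \<in> intring K"
    thus "x \<otimes>\<^bsub>ring_of_ints K\<^esub> a \<in> I" "a \<otimes>\<^bsub>ring_of_ints K\<^esub> x \<in> I"
      using mult[of x a] by (simp_all add: mult.commute)
  qed
qed

lemma idealD_ring_of_ints:
  assumes "ideal I (ring_of_ints K)"
  shows "I \<subseteq> intring K" "0 \<in> I" "\<And>x y. x \<in> I \<Longrightarrow> y \<in> I \<Longrightarrow> x + y \<in> I" "\<And>x. x \<in> I \<Longrightarrow> - x \<in> I"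
    "\<And>x y. x \<in> I \<Longrightarrow> y \<in> I \<Longrightarrow> x - y \<in> I"
    "\<And>r x. r \<in> intring K \<Longrightarrow> x \<in> I \<Longrightarrow> r * x \<in> I" "\<And>r x. r \<in> intring K \<Longrightarrow> x \<in> I \<Longrightarrow> x * r \<in> I"
proof -
  interpret ideal I "ring_of_ints K" by (rule assms)
  show "I \<subseteq> intring K" by (rule a_subset)
  show "0 \<in> I" using additive_subgroup.zero_closed[OF additive_subgroup_axioms] by simp
  show add: "\<And>x y. x \<in> I \<Longrightarrow> y \<in> I \<Longrightarrow> x + y \<in> I"
      using additive_subgroup.a_closed[OF additive_subgroup_axioms] by simp
  show mult: "\<And>r x. r \<in> intring K \<Longrightarrow> x \<in> I \<Longrightarrow> r * x \<in> I"
      using I_l_closed by simp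
  show "\<And>r x. r \<in> intring K \<Longrightarrow> x \<in> I \<Longrightarrow> x * r \<in> I"
      using I_r_closed by simp
  \<comment> \<open>\<open>K\<close> is an arbitrary set in this lemma, so -1 must be extracted from
    the ring structure contained in the ideal hypothesis.\<close>
  have "1 \<in> intring K" using one_closed by simp
  hence "\<ominus>\<^bsub>ring_of_ints K\<^esub> 1 \<in> intring K" "\<ominus>\<^bsub>ring_of_ints K\<^esub> 1 + 1 = 0"
    using a_inv_closed l_neg[of 1] by auto
  hence "- 1 \<in> intring K" by (metis eq_neg_iff_add_eq_0)
  thus neg: "\<And>x. x \<in> I \<Longrightarrow> - x \<in> I" using mult[of "-1"] by simp
  show "\<And>x y. x \<in> I \<Longrightarrow> y \<in> I \<Longrightarrow> x - y \<in> I"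
      using add neg by (metis uminus_add_conv_diff add.commute)
qed

text \<open>\<open>ideal_prod\<close> involves only the two ring operations and never the carrier,
  and all these rings share their operations with \<open>CC\<close>. Products can therefore be
  formed in one place for all fields, for fractional ideals and for sets from different
  fields.\<close>

lemma ideal_prod_ring_of_ints: "ideal_prod (ring_of_ints K) = ideal_prod CC"
proof (intro ext equalityI subsetI)
  fix I J x assume "x \<in> ideal_prod (ring_of_ints K) I J"
  thus "x \<in> ideal_prod CC I J"
    by induction (metis CC_simps ring_of_ints_simps ideal_prod.intros)+
next
  fix I J x assume "x \<in> ideal_prod CC I J"
  thus "x \<in> ideal_prod (ring_of_ints K) I J"
    by induction (metis CC_simps ring_of_ints_simps ideal_prod.intros)+
qed

lemma ideal_prod_CC_prod: "i \<in> I \<Longrightarrow> j \<in> J \<Longrightarrow> i * j \<in> ideal_prod CC I J"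
  using ideal_prod.prod[of i I j J CC] by simp

lemma ideal_prod_CC_add:
  "s \<in> ideal_prod CC I J \<Longrightarrow> t \<in> ideal_prod CC I J \<Longrightarrow> s + t \<in> ideal_prod CC I J"
  using ideal_prod.sum[of s CC I J t] by simp

lemma ideal_prod_CC_subset:
  assumes "\<And>i j. i \<in> I \<Longrightarrow> j \<in> J \<Longrightarrow> i * j \<in> M" "\<And>x y. x \<in> M \<Longrightarrow> y \<in> M \<Longrightarrow> x + y \<in> M"
  shows "ideal_prod CC I J \<subseteq> M"
proof
  fix z assume "z \<in> ideal_prod CC I J"
  thus "z \<in> M" by induction (use assms in auto)
qed

lemma ideal_prod_CC_commute: "ideal_prod CC I J = ideal_prod CC J I"
proof -
  have "ideal_prod CC I J \<subseteq> ideal_prod CC J I" for I J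
    by (rule ideal_prod_CC_subset) (subst mult.commute, auto intro: ideal_prod_CC_add ideal_prod_CC_prod)
  thus ?thesis by blast
qed

lemma ideal_prod_CC_assoc: "ideal_prod CC (ideal_prod CC I J) M = ideal_prod CC I (ideal_prod CC J M)"
proof -
  have *: "ideal_prod CC (ideal_prod CC I J) M \<subseteq> ideal_prod CC I (ideal_prod CC J M)" for I J M
  proof (rule ideal_prod_CC_subset)
    fix s k assume "s \<in> ideal_prod CC I J" "k \<in> M"
    thus "s * k \<in> ideal_prod CC I (ideal_prod CC J M)"
    proof (induction)
      case (prod i j)
      have "i * (j * k) \<in> ideal_prod CC I (ideal_prod CC J M)"
        by (intro ideal_prod_CC_prod prod)
      thus ?case by (simp add: mult.assoc)
    qed (simp add: distrib_right ideal_prod_CC_add)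
  qed (rule ideal_prod_CC_add)
  show ?thesis
  proof
    \<comment> \<open>The reverse inclusion is the first one for the reversed triple, rewritten by
      commutativity.\<close>
    show "ideal_prod CC I (ideal_prod CC J M) \<subseteq> ideal_prod CC (ideal_prod CC I J) M"
      using *[of M J I] by (metis ideal_prod_CC_commute)
  qed (rule *)
qed

text \<open>The hypotheses ask for closure only, not for an integral ideal, so that the unit law
  also covers fractional ideals.\<close>

lemma ideal_prod_CC_intring:
  assumes "1 \<in> intring K" "\<And>x y. x \<in> I \<Longrightarrow> y \<in> I \<Longrightarrow> x + y \<in> I" "\<And>r x. r \<in> intring K \<Longrightarrow> x \<in> I \<Longrightarrow> r * x \<in> I"
  shows "ideal_prod CC (intring K) I = I"
proof
  show "I \<subseteq> ideal_prod CC (intring K) I" using ideal_prod_CC_prod[OF assms(1)] by fastforce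
qed (intro ideal_prod_CC_subset assms)

lemma ideal_ideal_prod_CC:
  assumes "subfield K CC" "ideal I (ring_of_ints K)" "ideal J (ring_of_ints K)"
  shows "ideal (ideal_prod CC I J) (ring_of_ints K)"
  using ring.ideal_prod_is_ideal[OF _ assms(2,3)] cring.axioms(1)[OF cring_ring_of_ints[OF assms(1)]]
  by (simp add: ideal_prod_ring_of_ints)

section \<open>Powers of ideals and comaximality\<close>

abbreviation (input) ideal_pow :: "complex set \<Rightarrow> complex set \<Rightarrow> nat \<Rightarrow> complex set"
  where "ideal_pow K I k \<equiv> I [^]\<^bsub>ideals_set (ring_of_ints K)\<^esub> k"

lemma ideals_set_ring_of_ints_simps [simp]:
  "\<one>\<^bsub>ideals_set (ring_of_ints K)\<^esub> = intring K"
  "I \<otimes>\<^bsub>ideals_set (ring_of_ints K)\<^esub> J = ideal_prod CC I J"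
  by (simp_all add: ideals_set_def ideal_prod_ring_of_ints)

lemma ideal_intring: "subfield K CC \<Longrightarrow> ideal (intring K) (ring_of_ints K)"
  by (rule ideal_ring_of_intsI) (auto simp: intring_closed)

lemma ideal_ideal_pow:
  "subfield K CC \<Longrightarrow> ideal I (ring_of_ints K) \<Longrightarrow> ideal (ideal_pow K I k) (ring_of_ints K)"
  by (induction k) (auto simp: ideal_ideal_prod_CC ideal_intring)

lemma power_in_ideal_pow: "subfield K CC \<Longrightarrow> x \<in> I \<Longrightarrow> x ^ k \<in> ideal_pow K I k"
  by (induction k) (simp_all add: intring_closed mult.commute[of x] ideal_prod_CC_prod)

lemma comaximal_iff:
  assumes "subfield K CC" "ideal I (ring_of_ints K)" "ideal J (ring_of_ints K)"
  shows "comaximal K I J \<longleftrightarrow> (\<exists>i\<in>I. \<exists>j\<in>J. i + j = 1)"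
proof -
  note I = idealD_ring_of_ints[OF assms(2)] and J = idealD_ring_of_ints[OF assms(3)]
  have eq: "I <+>\<^bsub>ring_of_ints K\<^esub> J = {i + j | i j. i \<in> I \<and> j \<in> J}"
    by (auto simp: set_add_def')
  show ?thesis
  proof
    assume "comaximal K I J"
    hence "1 \<in> I <+>\<^bsub>ring_of_ints K\<^esub> J"
        using intring_closed(2)[OF assms(1)] by (simp add: comaximal_def)
    thus "\<exists>i\<in>I. \<exists>j\<in>J. i + j = 1" unfolding eq by force
  next
    assume "\<exists>i\<in>I. \<exists>j\<in>J. i + j = 1"
    then obtain i j where ij: "i \<in> I" "j \<in> J" "i + j = 1" by blast
    show "comaximal K I J" unfolding comaximal_def eq
    proof safe
      fix i j assume "i \<in> I" "j \<in> J"
      thus "i + j \<in> intring K" using I(1) J(1) by (blast intro: intring_closed(3)[OF assms(1)])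
    next
      fix x assume x: "x \<in> intring K"
      have "x = x * i + x * j" using ij(3) by (metis distrib_left mult.right_neutral)
      thus "\<exists>i j. x = i + j \<and> i \<in> I \<and> j \<in> J"
          using I(6)[OF x ij(1)] J(6)[OF x ij(2)] by blast
    qed
  qed
qed

text \<open>From \<open>i + m = 1\<close> and \<open>j + l = 1\<close> follows
  \<open>i * j + (m * j + l) = 1\<close>.\<close>

lemma comaximal_ideal_prod:
  assumes K: "subfield K CC"
      and id: "ideal I (ring_of_ints K)" "ideal J (ring_of_ints K)" "ideal M (ring_of_ints K)"
    and "comaximal K I M" "comaximal K J M"
  shows "comaximal K (ideal_prod CC I J) M"
proof -
  obtain i m where im: "i \<in> I" "m \<in> M" "i + m = 1"
      using assms(5) comaximal_iff[OF K id(1,3)] by blast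
  obtain j l where jl: "j \<in> J" "l \<in> M" "j + l = 1"
      using assms(6) comaximal_iff[OF K id(2,3)] by blast
  note M = idealD_ring_of_ints[OF id(3)]
  have "j \<in> intring K" using idealD_ring_of_ints(1)[OF id(2)] jl by auto
  moreover have "i * j + (m * j + l) = 1"
      using im(3) jl(3) by (simp add: add.assoc[symmetric] distrib_right[symmetric])
  ultimately show ?thesis
    using ideal_prod_CC_prod[OF im(1) jl(1)] M(3)[OF M(7)[OF _ im(2)] jl(2)]
    by (subst comaximal_iff[OF K ideal_ideal_prod_CC[OF K id(1,2)] id(3)]) blast
qed

lemma comaximal_intring: "subfield K CC \<Longrightarrow> ideal M (ring_of_ints K) \<Longrightarrow> comaximal K (intring K) M"
  by (subst comaximal_iff)
    (use idealD_ring_of_ints(2)[of M K] intring_closed(2)[of K] ideal_intring in force)+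

lemma comaximal_ideal_pow:
  assumes "subfield K CC" "ideal I (ring_of_ints K)" "ideal M (ring_of_ints K)" "comaximal K I M"
  shows "comaximal K (ideal_pow K I k) M"
  by (induction k) (use assms in \<open>auto simp: comaximal_intring comaximal_ideal_prod ideal_ideal_pow\<close>)

lemma comaximal_commute:
  assumes "subfield K CC" "ideal I (ring_of_ints K)" "ideal M (ring_of_ints K)"
  shows "comaximal K I M \<longleftrightarrow> comaximal K M I"
  unfolding comaximal_iff[OF assms(1,2,3)] comaximal_iff[OF assms(1,3,2)] by (metis add.commute)

section \<open>Principal ideals\<close>

abbreviation (input) pideal :: "complex set \<Rightarrow> complex \<Rightarrow> complex set"
  where "pideal K \<equiv> cgenideal (ring_of_ints K)"

lemma pideal_eq: "pideal K a = (\<lambda>x. x * a) ` intring K"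
  by (auto simp: cgenideal_def)

lemma pideal_1: "pideal K 1 = intring K"
  by (simp add: pideal_eq)

lemma self_in_pideal: "subfield K CC \<Longrightarrow> a \<in> pideal K a"
  unfolding pideal_eq using intring_closed(2) by force

lemma pideal_add: "subfield K CC \<Longrightarrow> x \<in> pideal K a \<Longrightarrow> y \<in> pideal K a \<Longrightarrow> x + y \<in> pideal K a"
  unfolding pideal_eq by (auto simp: image_iff distrib_right[symmetric] intro: intring_closed)

lemma pideal_mult: "subfield K CC \<Longrightarrow> r \<in> intring K \<Longrightarrow> x \<in> pideal K a \<Longrightarrow> r * x \<in> pideal K a"
  unfolding pideal_eq by (auto simp: image_iff mult.assoc[symmetric] intro: intring_closed)

lemma ideal_pideal: "subfield K CC \<Longrightarrow> a \<in> intring K \<Longrightarrow> ideal (pideal K a) (ring_of_ints K)"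
  by (rule cring.cgenideal_ideal[OF cring_ring_of_ints])

lemma ideal_prod_pideal:
  assumes "subfield K CC"
  shows "ideal_prod CC (pideal K a) (pideal K b) = pideal K (a * b)"
proof
  show "ideal_prod CC (pideal K a) (pideal K b) \<subseteq> pideal K (a * b)"
  proof (rule ideal_prod_CC_subset)
    fix i j assume "i \<in> pideal K a" "j \<in> pideal K b"
    then obtain x y where "x \<in> intring K" "y \<in> intring K" "i = x * a" "j = y * b"
        by (auto simp: pideal_eq)
    thus "i * j \<in> pideal K (a * b)"
        using intring_closed(5)[OF assms, of x y] by (auto simp: pideal_eq image_iff algebra_simps)
  qed (rule pideal_add[OF assms])
  show "pideal K (a * b) \<subseteq> ideal_prod CC (pideal K a) (pideal K b)"
  proof
    fix z assume "z \<in> pideal K (a * b)"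
    then obtain x where x: "x \<in> intring K" "z = (x * a) * b" by (auto simp: pideal_eq)
    moreover have "x * a \<in> pideal K a" using x by (auto simp: pideal_eq)
    ultimately show "z \<in> ideal_prod CC (pideal K a) (pideal K b)"
      using ideal_prod_CC_prod[OF _ self_in_pideal[OF assms]] by blast
  qed
qed

subsection \<open>Galois groups and restriction\<close>

lemma CC_nat_pow [simp]: "x [^]\<^bsub>CC\<^esub> (n :: nat) = x ^ n"
  by (induction n) (simp_all add: nat_pow_def mult.commute)

text \<open>Elements of \<open>BijGroup L\<close> are extensional, that is, \<open>undefined\<close>
  outside \<open>L\<close>. This lets automorphisms be compared on \<open>L\<close> alone, and it is
  why the identity and all restrictions appear as restricted functions.\<close>

lemma mem_Gal_iff:
  "\<sigma> \<in> carrier (Gal K L) \<longleftrightarrow> \<sigma> \<in> extensional L \<and> bij_betw \<sigma> L L \<and>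
     (\<forall>x\<in>L. \<forall>y\<in>L. \<sigma> (x + y) = \<sigma> x + \<sigma> y \<and> \<sigma> (x * y) = \<sigma> x * \<sigma> y) \<and> \<sigma> 1 = 1 \<and> (\<forall>x\<in>K. \<sigma> x = x)"
  by (auto simp: Gal_def Bij_def Ring.ring_hom_def bij_betw_imp_funcset dest: bij_betwE)

lemma Gal_one: "\<one>\<^bsub>Gal K L\<^esub> = (\<lambda>x\<in>L. x)"
  by (simp add: Gal_def BijGroup_def)

lemma Gal_mult:
  "\<sigma> \<in> carrier (Gal K L) \<Longrightarrow> \<rho> \<in> carrier (Gal K L) \<Longrightarrow> \<sigma> \<otimes>\<^bsub>Gal K L\<^esub> \<rho> = compose L \<sigma> \<rho>"
  by (simp add: Gal_def BijGroup_def)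

lemma GalD:
  assumes "\<sigma> \<in> carrier (Gal K L)"
  shows "x \<in> L \<Longrightarrow> \<sigma> x \<in> L" "x \<in> L \<Longrightarrow> y \<in> L \<Longrightarrow> \<sigma> (x + y) = \<sigma> x + \<sigma> y"
    "x \<in> L \<Longrightarrow> y \<in> L \<Longrightarrow> \<sigma> (x * y) = \<sigma> x * \<sigma> y" "\<sigma> 1 = 1" "x \<in> K \<Longrightarrow> \<sigma> x = x"
    "inj_on \<sigma> L" "\<sigma> ` L = L"
  using assms by (auto simp: mem_Gal_iff bij_betw_def)

lemma Gal_zero:
  assumes "\<sigma> \<in> carrier (Gal K L)" "subfield L CC"
  shows "\<sigma> 0 = 0"
  using GalD(2)[OF assms(1), of 0 0] subfield_CC_closed[OF assms(2)] by simp

lemma Gal_minus: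
  assumes "\<sigma> \<in> carrier (Gal K L)" "subfield L CC" "x \<in> L"
  shows "\<sigma> (- x) = - \<sigma> x"
  using GalD(2)[OF assms(1), of x "- x"] Gal_zero[OF assms(1,2)] subfield_CC_closed(4)[OF assms(2)] assms(3)
  by (simp add: eq_neg_iff_add_eq_0 add.commute)

lemma Gal_inverse:
  assumes "\<sigma> \<in> carrier (Gal K L)" "subfield L CC" "x \<in> L"
  shows "\<sigma> (inverse x) = inverse (\<sigma> x)"
proof (cases "x = 0")
  case False
  have "\<sigma> x * \<sigma> (inverse x) = 1"
    using GalD(3)[OF assms(1,3) subfield_CC_closed(7)[OF assms(2,3)]] GalD(4)[OF assms(1)] False by simp
  thus ?thesis by (metis inverse_unique)
qed (use Gal_zero[OF assms(1,2)] in simp)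

lemma compose_Gal:
  assumes "subfield L CC" "K \<subseteq> L" "\<sigma> \<in> carrier (Gal K L)" "\<rho> \<in> carrier (Gal K L)"
  shows "compose L \<sigma> \<rho> \<in> carrier (Gal K L)"
proof -
  have "bij_betw (compose L \<sigma> \<rho>) L L"
    using assms(3,4) by (auto simp: mem_Gal_iff intro: bij_betw_compose)
  thus ?thesis
    unfolding mem_Gal_iff
        using GalD[OF assms(3)] GalD[OF assms(4)] assms(2) subfield_CC_closed[OF assms(1)]
    by (auto simp: compose_def subset_iff)
qed

lemma group_Gal:
  assumes "subfield L CC" "K \<subseteq> L"
  shows "group (Gal K L)"
proof (rule groupI)
  fix \<sigma> \<rho> assume s: "\<sigma> \<in> carrier (Gal K L)" "\<rho> \<in> carrier (Gal K L)"
  show "\<sigma> \<otimes>\<^bsub>Gal K L\<^esub> \<rho> \<in> carrier (Gal K L)"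
    unfolding Gal_mult[OF s] by (rule compose_Gal[OF assms s])
next
  show "\<one>\<^bsub>Gal K L\<^esub> \<in> carrier (Gal K L)"
    unfolding Gal_one mem_Gal_iff using assms subfield_CC_closed[OF assms(1)]
    by (auto simp: bij_betw_def inj_on_def)
next
  fix \<sigma> \<rho> \<nu> assume s: "\<sigma> \<in> carrier (Gal K L)" "\<rho> \<in> carrier (Gal K L)" "\<nu> \<in> carrier (Gal K L)"
  show "\<sigma> \<otimes>\<^bsub>Gal K L\<^esub> \<rho> \<otimes>\<^bsub>Gal K L\<^esub> \<nu> = \<sigma> \<otimes>\<^bsub>Gal K L\<^esub> (\<rho> \<otimes>\<^bsub>Gal K L\<^esub> \<nu>)"
    using GalD(1)[OF s(3)]
    by (simp add: s Gal_mult compose_Gal[OF assms] compose_assoc[of \<nu> L L \<sigma> \<rho>])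
next
  fix \<sigma> assume s: "\<sigma> \<in> carrier (Gal K L)"
  have id: "(\<lambda>x\<in>L. x) \<in> carrier (Gal K L)"
    unfolding mem_Gal_iff using assms subfield_CC_closed[OF assms(1)]
    by (auto simp: bij_betw_def inj_on_def)
  show "\<one>\<^bsub>Gal K L\<^esub> \<otimes>\<^bsub>Gal K L\<^esub> \<sigma> = \<sigma>"
    unfolding Gal_one using s id GalD(1)[OF s]
    by (auto simp: Gal_mult compose_def mem_Gal_iff extensional_def fun_eq_iff)
  define \<rho> where "\<rho> = (\<lambda>x\<in>L. inv_into L \<sigma> x)"
  have bij: "bij_betw \<sigma> L L" using s by (simp add: mem_Gal_iff)
  have \<rho>L: "\<rho> x \<in> L" "\<sigma> (\<rho> x) = x" if "x \<in> L" for x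
    using that GalD(7)[OF s] by (auto simp: \<rho>_def inv_into_into f_inv_into_f)
  have \<rho>I: "\<rho> x = y" if "x \<in> L" "y \<in> L" "\<sigma> y = x" for x y
    using that \<rho>L[OF that(1)] GalD(6)[OF s] by (metis inj_onD)
  have "\<rho> \<in> carrier (Gal K L)"
    unfolding mem_Gal_iff
  proof (intro conjI ballI)
    show "bij_betw \<rho> L L" unfolding \<rho>_def
        using bij_betw_inv_into[OF bij] by (simp cong: bij_betw_cong)
    show "\<rho> \<in> extensional L" by (simp add: \<rho>_def)
  qed (use assms(2) subfield_CC_closed[OF assms(1)] GalD[OF s] \<rho>L in \<open>auto intro!: \<rho>I\<close>)
  moreover have "\<rho> \<otimes>\<^bsub>Gal K L\<^esub> \<sigma> = \<one>\<^bsub>Gal K L\<^esub>"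
    unfolding Gal_mult[OF calculation s] Gal_one using GalD(1)[OF s]
    by (auto simp: compose_def fun_eq_iff intro: \<rho>I)
  ultimately show "\<exists>\<rho>\<in>carrier (Gal K L). \<rho> \<otimes>\<^bsub>Gal K L\<^esub> \<sigma> = \<one>\<^bsub>Gal K L\<^esub>" by blast
qed

lemma Gal_pow_apply:
  assumes "subfield L CC" "K \<subseteq> L" "\<sigma> \<in> carrier (Gal K L)" "x \<in> L"
  shows "(\<sigma> [^]\<^bsub>Gal K L\<^esub> (k :: nat)) x = (\<sigma> ^^ k) x"
  using assms(4)
proof (induction k arbitrary: x)
  case (Suc k)
  interpret group "Gal K L" by (rule group_Gal[OF assms(1,2)])
  have "\<sigma> [^]\<^bsub>Gal K L\<^esub> k \<in> carrier (Gal K L)" using assms(3) by simp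
  thus ?case using Suc GalD(1)[OF assms(3)] assms(3)
    by (simp add: Gal_mult compose_def funpow_swap1)
qed (simp add: Gal_one)

lemma Gal_eq_one_iff:
  assumes "\<sigma> \<in> carrier (Gal K L)"
  shows "\<sigma> = \<one>\<^bsub>Gal K L\<^esub> \<longleftrightarrow> (\<forall>x\<in>L. \<sigma> x = x)"
  using assms by (auto simp: Gal_one mem_Gal_iff extensional_def fun_eq_iff)

lemma Gal_pow_eq_one_iff:
  assumes "subfield L CC" "K \<subseteq> L" "\<sigma> \<in> carrier (Gal K L)"
  shows "\<sigma> [^]\<^bsub>Gal K L\<^esub> (k :: nat) = \<one>\<^bsub>Gal K L\<^esub> \<longleftrightarrow> (\<forall>x\<in>L. (\<sigma> ^^ k) x = x)"
proof -
  interpret group "Gal K L" by (rule group_Gal[OF assms(1,2)])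
  show ?thesis
    using Gal_eq_one_iff[of "\<sigma> [^]\<^bsub>Gal K L\<^esub> k" K L] Gal_pow_apply[OF assms] assms(3)
        by simp
qed

lemma Gal_poly:
  assumes "subfield L CC" "K \<subseteq> L" "\<sigma> \<in> carrier (Gal K L)" "a \<in> L" "\<And>i. Polynomial.coeff p i \<in> K"
  shows "\<sigma> (poly p a) = poly p (\<sigma> a) \<and> poly p a \<in> L"
  using assms(5)
proof (induction p)
  case (pCons c p)
  have "c \<in> K" using pCons.prems[of 0] by simp
  moreover have "Polynomial.coeff p i \<in> K" for i using pCons.prems[of "Suc i"] by simp
  hence "\<sigma> (poly p a) = poly p (\<sigma> a) \<and> poly p a \<in> L" by (rule pCons.IH)
  ultimately show ?case
    using assms(2,4) subfield_CC_closed[OF assms(1)] GalD[OF assms(3)] by (auto simp: subset_iff)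
qed (simp add: Gal_zero[OF assms(3,1)] subfield_CC_closed[OF assms(1)])

text \<open>In a finite extension \<open>a\<close> is algebraic over \<open>K\<close>, and each
  automorphism sends it to another root of the same nonzero polynomial over
  \<open>K\<close>.\<close>

lemma Gal_orbit_finite:
  assumes "galois_extension K M" "a \<in> M"
  shows "finite ((\<lambda>\<rho>. \<rho> a) ` carrier (Gal K M))"
proof -
  from assms(1) have K: "subfield K CC" and M: "subfield M CC" and KM: "K \<subseteq> M"
    and fd: "ring.finite_dimension CC K M" by (auto simp: galois_extension_def)
  interpret field CC by (rule field_CC)
  have "(algebraic over K) a"
    using finite_dimension_imp_algebraic[OF K subfieldE(1)[OF M] fd assms(2)] .
  then obtain p where p: "p \<in> carrier (K[X]\<^bsub>CC\<^esub>)" "p \<noteq> []" "eval p a = 0"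
    using algebraicE[OF subfieldE(1)[OF K], of a] by auto
  have pK: "set p \<subseteq> K" using p(1) by (auto simp: univ_poly_def polynomial_def)
  \<comment> \<open>The polynomial delivered by algebraicity is a coefficient list with leading
    coefficient first, so compatibility with \<rho> is an induction on lists with head term
    \<open>c * a ^ length q\<close>.\<close>
  have ev: "\<rho> (eval q a) = eval q (\<rho> a) \<and> eval q a \<in> M"
      if "set q \<subseteq> K" "\<rho> \<in> carrier (Gal K M)" for q \<rho>
    using that(1)
  proof (induction q)
    case (Cons c q)
    have pw: "\<rho> (a ^ n) = \<rho> a ^ n \<and> a ^ n \<in> M" for n
      by (induction n) (use assms(2) GalD[OF that(2)] subfield_CC_closed[OF M] in auto)
    show ?case using Cons pw[of "length q"] KM subfield_CC_closed[OF M] GalD[OF that(2)]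
      by (auto simp: subset_iff)
  qed (simp add: Gal_zero[OF that(2) M] subfield_CC_closed[OF M])
  have "eval p (\<rho> a) = 0" if "\<rho> \<in> carrier (Gal K M)" for \<rho>
    using ev[OF pK that] p(3) Gal_zero[OF that M] by simp
  hence "(\<lambda>\<rho>. \<rho> a) ` carrier (Gal K M) \<subseteq> {x. is_root p x}"
    using p(2) by (auto simp: is_root_def)
  moreover have "finite {x. is_root p x}"
    using p(1) by (intro finite_number_of_roots) (auto simp: univ_poly_def polynomial_def)
  ultimately show ?thesis by (rule finite_subset)
qed

text \<open>The two claims are proved together because \<rho> respects sums and products only inside
  \<open>M\<close>; the induction must carry membership of the coefficients.\<close>

lemma Gal_coeff_prod:
  assumes "subfield M CC" "\<rho> \<in> carrier (Gal K M)" "finite T" "T \<subseteq> M"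
  shows "\<rho> (Polynomial.coeff (\<Prod>b\<in>T. [:- b, 1:]) i) = Polynomial.coeff (\<Prod>b\<in>T. [:- \<rho> b, 1:]) i \<and>
         Polynomial.coeff (\<Prod>b\<in>T. [:- b, 1:]) i \<in> M"
  using assms(3,4)
proof (induction T arbitrary: i)
  case empty
  thus ?case using GalD(4)[OF assms(2)] Gal_zero[OF assms(2,1)] subfield_CC_closed[OF assms(1)]
    by (cases i) auto
next
  case (insert b T)
  let ?c = "Polynomial.coeff (\<Prod>b\<in>T. [:- b, 1:])"
  let ?d = "case i of 0 \<Rightarrow> 0 | Suc j \<Rightarrow> ?c j"
  have IH: "\<rho> (?c j) = Polynomial.coeff (\<Prod>b\<in>T. [:- \<rho> b, 1:]) j" "?c j \<in> M" for j
    using insert by auto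
  have b: "b \<in> M" using insert by simp
  have eq: "Polynomial.coeff ([:- e, 1:] * q) i = - e * Polynomial.coeff q i + (case i of 0 \<Rightarrow> 0 | Suc j \<Rightarrow> Polynomial.coeff q j)"
    for e :: complex and q
    by (cases i) (auto simp: mult_pCons_left)
  have d: "?d \<in> M" "\<rho> ?d = (case i of 0 \<Rightarrow> 0 | Suc j \<Rightarrow> \<rho> (?c j))"
    using IH(2) subfield_CC_closed(1)[OF assms(1)] Gal_zero[OF assms(2,1)] by (cases i; simp)+
  have bc: "- b * ?c i \<in> M" "\<rho> (- b * ?c i) = - \<rho> b * \<rho> (?c i)"
    using IH(2)[of i] b subfield_CC_closed[OF assms(1)] GalD(3)[OF assms(2)] Gal_minus[OF assms(2,1)]
        by auto
  have "\<rho> (- b * ?c i + ?d) = - \<rho> b * \<rho> (?c i) + (case i of 0 \<Rightarrow> 0 | Suc j \<Rightarrow> \<rho> (?c j))"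
    using GalD(2)[OF assms(2) bc(1) d(1)] d(2) bc(2) by simp
  moreover have "- b * ?c i + ?d \<in> M" using subfield_CC_closed(3)[OF assms(1) bc(1) d(1)] .
  ultimately show ?case unfolding prod.insert[OF insert(1,2)] eq IH(1)[symmetric] by blast
qed

text \<open>The conjugates of \<open>a\<close> over \<open>K\<close> are the roots of the polynomial with roots the orbit of \<open>a\<close>,
  whose coefficients are fixed by the Galois group.\<close>
lemma Gal_maps_galois_subextension:
  assumes L: "subfield L CC" and M: "galois_extension K M"
      and "M \<subseteq> L" "\<sigma> \<in> carrier (Gal K L)" "a \<in> M"
  shows "\<sigma> a \<in> M"
proof -
  from M have sM: "subfield M CC" and KM: "K \<subseteq> M"
    and fixed: "{x \<in> M. \<forall>\<sigma>\<in>carrier (Gal K M). \<sigma> x = x} = K"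
        by (auto simp: galois_extension_def)
  interpret group "Gal K M" by (rule group_Gal[OF sM KM])
  define S where "S = (\<lambda>\<rho>. \<rho> a) ` carrier (Gal K M)"
  define P where "P = (\<Prod>b\<in>S. [:- b, 1:])"
  have fin: "finite S" unfolding S_def by (rule Gal_orbit_finite[OF M assms(5)])
  have SM: "S \<subseteq> M" using GalD(1) assms(5) by (auto simp: S_def)
  have aS: "a \<in> S" unfolding S_def using one_closed assms(5)
    by (intro image_eqI[of _ _ "\<one>\<^bsub>Gal K M\<^esub>"]) (auto simp: Gal_one)
  have "Polynomial.coeff P i \<in> K" for i
  proof -
    have "\<rho> (Polynomial.coeff P i) = Polynomial.coeff P i"
        if "\<rho> \<in> carrier (Gal K M)" for \<rho>
    proof -
      \<comment> \<open>Together with injectivity and finiteness this makes \<rho> a permutation of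
        the orbit, which only reorders the linear factors of \<open>P\<close>.\<close>
      have "\<rho> ` S \<subseteq> S"
      proof
        fix y assume "y \<in> \<rho> ` S"
        then obtain \<nu> where \<nu>: "\<nu> \<in> carrier (Gal K M)" "y = \<rho> (\<nu> a)"
            by (auto simp: S_def)
        hence "y = (\<rho> \<otimes>\<^bsub>Gal K M\<^esub> \<nu>) a"
            using that assms(5) by (simp add: Gal_mult compose_def)
        thus "y \<in> S" unfolding S_def using m_closed[OF that \<nu>(1)] by blast
      qed
      moreover have inj: "inj_on \<rho> S" using GalD(6)[OF that] SM by (rule inj_on_subset)
      ultimately have "\<rho> ` S = S" using fin by (simp add: endo_inj_surj)
      hence "(\<Prod>b\<in>S. [:- \<rho> b, 1:]) = P"
        unfolding P_def using prod.reindex[OF inj, of "\<lambda>b. [:- b, 1:]"] by (simp add: o_def)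
      thus ?thesis using Gal_coeff_prod[OF sM that fin SM, of i] by (simp add: P_def)
    qed
    moreover have "Polynomial.coeff P i \<in> M"
      using Gal_coeff_prod[OF sM one_closed fin SM] by (simp add: P_def)
    ultimately show ?thesis using fixed by blast
  qed
  \<comment> \<open>Here \<sigma> acts on the larger field \<open>L\<close> and is not yet known to
    preserve \<open>M\<close>; having coefficients in \<open>K\<close> is what allows it to pass
    through \<open>P\<close>.\<close>
  hence "poly P (\<sigma> a) = \<sigma> (poly P a)"
    using Gal_poly[OF L order_trans[OF KM assms(3)] assms(4) subsetD[OF assms(3,5)], of P] by simp
  also have "poly P a = 0" using aS fin by (auto simp: P_def poly_prod)
  finally have "poly P (\<sigma> a) = 0" using Gal_zero[OF assms(4) L] by simp
  hence "\<sigma> a \<in> S" using fin by (auto simp: P_def poly_prod)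
  thus ?thesis using SM by blast
qed

lemma restrict_Gal:
  assumes L: "subfield L CC" and M: "galois_extension K M"
      and "M \<subseteq> L" "\<sigma> \<in> carrier (Gal K L)"
  shows "restrict \<sigma> M \<in> carrier (Gal K M)"
proof -
  from M have sM: "subfield M CC" and KM: "K \<subseteq> M" by (auto simp: galois_extension_def)
  have KL: "K \<subseteq> L" using KM assms(3) by blast
  interpret group "Gal K L" by (rule group_Gal[OF L KL])
  have into: "\<rho> x \<in> M" if "\<rho> \<in> carrier (Gal K L)" "x \<in> M" for \<rho> x
    using Gal_maps_galois_subextension[OF L M assms(3) that] .
  have "\<sigma> ` M = M"
  proof
    \<comment> \<open>The inverse automorphism of \<open>L\<close> maps \<open>M\<close> into itself
      as well, which yields preimages in \<open>M\<close>.\<close>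
    show "M \<subseteq> \<sigma> ` M"
    proof
      fix x assume x: "x \<in> M"
      let ?i = "inv\<^bsub>Gal K L\<^esub> \<sigma>"
      have i: "?i \<in> carrier (Gal K L)" using assms(4) by simp
      have "(\<sigma> \<otimes>\<^bsub>Gal K L\<^esub> ?i) x = x"
          using assms(3,4) x by (auto simp: Gal_one)
      hence "\<sigma> (?i x) = x" using Gal_mult[OF assms(4) i] x assms(3) by (auto simp: compose_def)
      thus "x \<in> \<sigma> ` M" using into[OF i x] by (metis imageI)
    qed
  qed (use into[OF assms(4)] in auto)
  moreover have "inj_on \<sigma> M" using GalD(6)[OF assms(4)] assms(3) by (rule inj_on_subset)
  ultimately have "bij_betw (restrict \<sigma> M) M M" by (simp add: bij_betw_def)
  thus ?thesis unfolding mem_Gal_iff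
    using GalD[OF assms(4)] subfield_CC_closed[OF sM] KM assms(3) by (auto simp: subset_iff)
qed

lemma restrict_funpow:
  assumes "\<And>x. x \<in> M \<Longrightarrow> \<sigma> x \<in> M" "x \<in> M"
  shows "(restrict \<sigma> M ^^ k) x = (\<sigma> ^^ k) x"
proof -
  have "(restrict \<sigma> M ^^ k) x = (\<sigma> ^^ k) x \<and> (\<sigma> ^^ k) x \<in> M"
    by (induction k) (use assms in auto)
  thus ?thesis ..
qed

text \<open>An automorphism fixing \<open>M\<close> and \<open>N\<close> pointwise fixes the field
  they generate, by induction on its generation. This splits the order of \<tau> into one condition
  on the ray class field and one on the ring class field.\<close>

lemma compositum_Gal_pow_eq_one_iff:
  fixes k :: nat
  assumes M: "galois_extension K M" and N: "galois_extension K N"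
    and \<sigma>: "\<sigma> \<in> carrier (Gal K (compositum M N))"
  shows "\<sigma> [^]\<^bsub>Gal K (compositum M N)\<^esub> k = \<one>\<^bsub>Gal K (compositum M N)\<^esub> \<longleftrightarrow>
     restrict \<sigma> M [^]\<^bsub>Gal K M\<^esub> k = \<one>\<^bsub>Gal K M\<^esub> \<and> restrict \<sigma> N [^]\<^bsub>Gal K N\<^esub> k = \<one>\<^bsub>Gal K N\<^esub>"
proof -
  define L where "L = compositum M N"
  have L: "subfield L CC" unfolding L_def compositum_def by (rule subfield_CC_generate_field)
  have sub: "M \<subseteq> L" "N \<subseteq> L"
      by (auto simp: L_def compositum_def intro: generate_field.incl)
  have sM: "subfield M CC" and KM: "K \<subseteq> M" and sN: "subfield N CC" and KN: "K \<subseteq> N"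
    using M N by (auto simp: galois_extension_def)
  have KL: "K \<subseteq> L" using KM sub by blast
  have \<sigma>: "\<sigma> \<in> carrier (Gal K L)" using assms(3) by (simp add: L_def)
  interpret group "Gal K L" by (rule group_Gal[OF L KL])
  let ?\<rho> = "\<sigma> [^]\<^bsub>Gal K L\<^esub> k"
  have \<rho>: "?\<rho> \<in> carrier (Gal K L)" using \<sigma> by simp
  have "?\<rho> x = x"
      if "\<forall>x\<in>M. ?\<rho> x = x" "\<forall>x\<in>N. ?\<rho> x = x" "x \<in> L" for x
  proof -
    have "x \<in> generate_field CC (M \<union> N)" using that(3) by (simp add: L_def compositum_def)
    thus ?thesis
    proof induction
      case one thus ?case using GalD(4)[OF \<rho>] by simp
    next
      case (incl h) thus ?case using that by blast
    next
      case (a_inv h) thus ?case using Gal_minus[OF \<rho> L, of h] by (simp add: L_def compositum_def)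
    next
      case (m_inv h) thus ?case using Gal_inverse[OF \<rho> L, of h] by (simp add: L_def compositum_def)
    next
      case (eng_add h1 h2) thus ?case
          using GalD(2)[OF \<rho>, of h1 h2] by (simp add: L_def compositum_def)
    next
      case (eng_mult h1 h2) thus ?case
          using GalD(3)[OF \<rho>, of h1 h2] by (simp add: L_def compositum_def)
    qed
  qed
  hence "?\<rho> = \<one>\<^bsub>Gal K L\<^esub> \<longleftrightarrow> (\<forall>x\<in>M. ?\<rho> x = x) \<and> (\<forall>x\<in>N. ?\<rho> x = x)"
    using Gal_eq_one_iff[OF \<rho>] sub by blast
  also have "(\<forall>x\<in>M. ?\<rho> x = x) \<longleftrightarrow> restrict \<sigma> M [^]\<^bsub>Gal K M\<^esub> k = \<one>\<^bsub>Gal K M\<^esub>"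
    using Gal_pow_eq_one_iff[OF sM KM restrict_Gal[OF L M sub(1) \<sigma>]] Gal_pow_apply[OF L KL \<sigma>] subsetD[OF sub(1)]
      restrict_funpow[of M \<sigma>, OF Gal_maps_galois_subextension[OF L M sub(1) \<sigma>]] by simp
  also have "(\<forall>x\<in>N. ?\<rho> x = x) \<longleftrightarrow> restrict \<sigma> N [^]\<^bsub>Gal K N\<^esub> k = \<one>\<^bsub>Gal K N\<^esub>"
    using Gal_pow_eq_one_iff[OF sN KN restrict_Gal[OF L N sub(2) \<sigma>]] Gal_pow_apply[OF L KL \<sigma>] subsetD[OF sub(2)]
      restrict_funpow[of N \<sigma>, OF Gal_maps_galois_subextension[OF L N sub(2) \<sigma>]] by simp
  finally show ?thesis unfolding L_def .
qed

subsection \<open>Ray and ring subgroups\<close>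

lemma ideal_group_simps [simp]:
  "I \<otimes>\<^bsub>ideal_group K m\<^esub> J = ideal_prod CC I J" "\<one>\<^bsub>ideal_group K m\<^esub> = intring K"
  by (simp_all add: ideal_group_def)

text \<open>A fractional ideal inherits its closure properties from the integral multiple by
  \<open>c\<close>, after cancelling \<open>c\<close>. The unit law is used to identify inverses and
  to evaluate the Artin map at the zeroth power.\<close>

lemma ideal_group_ideal_prod_intring:
  assumes K: "subfield K CC" and y: "y \<in> carrier (ideal_group K m)"
  shows "ideal_prod CC (intring K) y = y"
proof -
  from y obtain c where c: "c \<noteq> 0" "ideal ((\<lambda>x. c * x) ` y) (ring_of_ints K)"
    by (auto simp: ideal_group_def fractional_ideal_def)
  note I = idealD_ring_of_ints[OF c(2)]
  show ?thesis
  proof (rule ideal_prod_CC_intring)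
    show "1 \<in> intring K" by (rule intring_closed[OF K])
  next
    fix u v assume "u \<in> y" "v \<in> y"
    hence "c * u + c * v \<in> (\<lambda>x. c * x) ` y" by (intro I(3)) auto
    thus "u + v \<in> y" using c(1) by (auto simp flip: distrib_left)
  next
    fix r u assume "r \<in> intring K" "u \<in> y"
    hence "r * (c * u) \<in> (\<lambda>x. c * x) ` y" using I(6)[of r "c * u"] by blast
    thus "r * u \<in> y" using c(1) by (auto simp: mult.left_commute[of r])
  qed
qed

lemma neq_zero_ideal: "x \<in> I \<Longrightarrow> x \<noteq> 0 \<Longrightarrow> I \<noteq> {0 :: complex}"
  by blast

lemma integral_ideal_in_ideal_group:
  assumes K: "subfield K CC"
      and "ideal m (ring_of_ints K)" "ideal I (ring_of_ints K)" "I \<noteq> {0}" "comaximal K I m"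
  shows "I \<in> carrier (ideal_group K m)"
proof -
  have "fractional_ideal K I"
    unfolding fractional_ideal_def
        using assms idealD_ring_of_ints(1)[OF assms(3)] intring_closed(2)[OF K]
    by (auto simp: mem_intring_iff intro!: bexI[of _ 1])
  moreover have "ideal_prod CC I (intring K) = I"
    by (subst ideal_prod_CC_commute, rule ideal_prod_CC_intring)
      (simp_all add: intring_closed(2)[OF K] idealD_ring_of_ints[OF assms(3)])
  moreover have "intring K \<noteq> {0}" using intring_closed(2)[OF K] by auto
  ultimately show ?thesis
    using assms ideal_intring[OF K] comaximal_intring[OF K assms(2)] by (auto simp: ideal_group_def)
qed

text \<open>The ideal is the quotient of the unit ideal by \<open>pideal K a\<close>, and
  \<open>a\<close> itself serves as the denominator that makes it integral.\<close>

lemma pideal_inverse_in_ideal_group: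
  assumes K: "subfield K CC" and m: "ideal m (ring_of_ints K)"
    and a: "a \<in> intring K" "a \<noteq> 0" "comaximal K (pideal K a) m"
  shows "pideal K (inverse a) \<in> carrier (ideal_group K m)"
proof -
  have "pideal K (inverse a) \<subseteq> K"
    unfolding pideal_eq using a by (auto simp: mem_intring_iff subfield_CC_closed[OF K])
  moreover have "pideal K a \<noteq> {0}" "pideal K (inverse a) \<noteq> {0}"
    using neq_zero_ideal[OF self_in_pideal[OF K]] a(2) by simp_all
  moreover have "(\<lambda>x. a * x) ` pideal K (inverse a) = intring K"
    unfolding pideal_eq image_image using a(2) by (simp add: mult.left_commute[of a])
  ultimately have "fractional_ideal K (pideal K (inverse a))"
    unfolding fractional_ideal_def using a ideal_intring[OF K] by metis
  moreover have "ideal_prod CC (pideal K (inverse a)) (pideal K a) = intring K"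
    using a(2) by (simp add: ideal_prod_pideal[OF K] pideal_1)
  moreover have "intring K \<noteq> {0}" using intring_closed(2)[OF K] by auto
  ultimately show ?thesis
    using \<open>pideal K a \<noteq> {0}\<close> a ideal_intring[OF K] comaximal_intring[OF K m] ideal_pideal[OF K a(1)]
    by (auto simp: ideal_group_def)
qed

text \<open>\<open>m_inv\<close> is a definite description over the carrier, so uniqueness has to be
  shown too: any candidate \<open>y\<close> is recovered by multiplying with the ideals of
  \<open>inverse a\<close> and \<open>a\<close>.\<close>

lemma inv_pideal_ideal_group:
  assumes K: "subfield K CC" and m: "ideal m (ring_of_ints K)"
    and a: "a \<in> intring K" "a \<noteq> 0" "comaximal K (pideal K a) m"
  shows "inv\<^bsub>ideal_group K m\<^esub> (pideal K a) = pideal K (inverse a)"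
  unfolding m_inv_def
proof (rule the_equality)
  show "pideal K (inverse a) \<in> carrier (ideal_group K m) \<and>
    pideal K a \<otimes>\<^bsub>ideal_group K m\<^esub> pideal K (inverse a) = \<one>\<^bsub>ideal_group K m\<^esub> \<and>
    pideal K (inverse a) \<otimes>\<^bsub>ideal_group K m\<^esub> pideal K a = \<one>\<^bsub>ideal_group K m\<^esub>"
    using a(2) by (simp add: pideal_inverse_in_ideal_group[OF assms] ideal_prod_pideal[OF K] pideal_1)
next
  fix y assume "y \<in> carrier (ideal_group K m) \<and> pideal K a \<otimes>\<^bsub>ideal_group K m\<^esub> y = \<one>\<^bsub>ideal_group K m\<^esub> \<and>
    y \<otimes>\<^bsub>ideal_group K m\<^esub> pideal K a = \<one>\<^bsub>ideal_group K m\<^esub>"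
  hence y: "y \<in> carrier (ideal_group K m)" "ideal_prod CC (pideal K a) y = intring K" by auto
  have "y = ideal_prod CC (pideal K (inverse a * a)) y"
    using ideal_group_ideal_prod_intring[OF K y(1)] a(2) by (simp add: pideal_1)
  also have "\<dots> = ideal_prod CC (pideal K (inverse a)) (pideal K 1)"
    by (simp only: ideal_prod_pideal[OF K, symmetric] ideal_prod_CC_assoc y(2) pideal_1)
  also have "\<dots> = pideal K (inverse a)" by (simp add: ideal_prod_pideal[OF K])
  finally show "y = pideal K (inverse a)" .
qed

text \<open>Common core of the ray and ring subgroups: since \<open>S\<close> is multiplicatively
  closed, words in generators and inverses collapse to a single quotient. Comaximality with
  \<open>m\<close> makes the inverses of the generators exist in the ideal group.\<close>

lemma generate_principal_ideals:
  assumes K: "subfield K CC" and m: "ideal m (ring_of_ints K)" and "1 \<in> S"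
    and S: "\<And>a. a \<in> S \<Longrightarrow> a \<in> intring K \<and> a \<noteq> 0 \<and> comaximal K (pideal K a) m"
    and mult: "\<And>a b. a \<in> S \<Longrightarrow> b \<in> S \<Longrightarrow> a * b \<in> S"
  shows "generate (ideal_group K m) {pideal K a | a. a \<in> S} = {pideal K (a / b) | a b. a \<in> S \<and> b \<in> S}"
    (is "?G = ?F")
proof
  have F: "pideal K (a / b) \<in> ?F" if "a \<in> S" "b \<in> S" for a b using that by blast
  show "?G \<subseteq> ?F"
  proof
    fix I assume "I \<in> ?G"
    thus "I \<in> ?F"
    proof induction
      case one
      show ?case using F[OF assms(3,3)] by (simp add: pideal_1)
    next
      case (incl h)
      then obtain a where "h = pideal K a" "a \<in> S" by blast
      thus ?case using F[of a 1] assms(3) by simp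
    next
      case (inv h)
      then obtain a where a: "h = pideal K a" "a \<in> S" by blast
      have "inv\<^bsub>ideal_group K m\<^esub> h = pideal K (inverse a)"
        unfolding a(1) using S[OF a(2)] by (intro inv_pideal_ideal_group[OF K m]) auto
      thus ?case using F[OF assms(3) a(2)] by (simp add: inverse_eq_divide)
    next
      case (eng h1 h2)
      then obtain a b c e
          where "h1 = pideal K (a / b)" "h2 = pideal K (c / e)" "a \<in> S" "b \<in> S" "c \<in> S" "e \<in> S" by blast
      thus ?case using F[of "a * c" "b * e"] mult by (simp add: ideal_prod_pideal[OF K])
    qed
  qed
  show "?F \<subseteq> ?G"
  proof safe
    fix a b assume ab: "a \<in> S" "b \<in> S"
    have "pideal K a \<otimes>\<^bsub>ideal_group K m\<^esub> inv\<^bsub>ideal_group K m\<^esub> (pideal K b) \<in> ?G"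
      using ab by (intro generate.eng generate.incl generate.inv) auto
    moreover have "inv\<^bsub>ideal_group K m\<^esub> (pideal K b) = pideal K (inverse b)"
      using S[OF ab(2)] by (intro inv_pideal_ideal_group[OF K m]) auto
    ultimately show "pideal K (a / b) \<in> ?G"
      by (simp add: ideal_prod_pideal[OF K] divide_inverse)
  qed
qed

lemma in_pideal_imp_in_intring:
  "subfield K CC \<Longrightarrow> I \<subseteq> intring K \<Longrightarrow> I = pideal K c \<Longrightarrow> c \<in> intring K"
  using self_in_pideal by blast

text \<open>If the ideal (a/b) is integral, then a/b is an algebraic integer of \<open>K\<close>,
  and \<open>(a - 1) - (a / b) * (b - 1) = a / b - 1\<close> moves the congruence to the
  quotient.\<close>

lemma mem_ray_subgroup_iff:
  assumes K: "subfield K CC" and m: "ideal m (ring_of_ints K)"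
      and I: "I \<subseteq> intring K" "I \<noteq> {0}"
  shows "I \<in> ray_subgroup K m \<longleftrightarrow> (\<exists>\<alpha>. I = pideal K \<alpha> \<and> \<alpha> - 1 \<in> m)"
proof -
  let ?S = "{a \<in> intring K. a \<noteq> 0 \<and> a - 1 \<in> m}"
  note mD = idealD_ring_of_ints[OF m]
  have "ray_subgroup K m = generate (ideal_group K m) {pideal K a | a. a \<in> ?S}"
    by (simp add: ray_subgroup_def)
  also have "\<dots> = {pideal K (a / b) | a b. a \<in> ?S \<and> b \<in> ?S}"
  proof (rule generate_principal_ideals[OF K m])
    show "1 \<in> ?S" using mD(2) intring_closed(2)[OF K] by simp
    show "a \<in> intring K \<and> a \<noteq> 0 \<and> comaximal K (pideal K a) m" if "a \<in> ?S" for a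
    proof -
      have "1 - a \<in> m" using that mD(4)[of "a - 1"] by simp
      moreover have "a + (1 - a) = 1" by simp
      ultimately show ?thesis
        using that self_in_pideal[OF K] by (subst comaximal_iff[OF K ideal_pideal[OF K] m]) blast+
    qed
    show "a * b \<in> ?S" if "a \<in> ?S" "b \<in> ?S" for a b
    proof -
      have "a * (b - 1) + (a - 1) \<in> m" using that mD(3)[OF mD(6)[of a "b - 1"]] by blast
      thus ?thesis using that by (simp add: algebra_simps intring_closed[OF K])
    qed
  qed
  finally have eq: "ray_subgroup K m = {pideal K (a / b) | a b. a \<in> ?S \<and> b \<in> ?S}" .
  show ?thesis
  proof
    assume "I \<in> ray_subgroup K m"
    then obtain a b where ab: "I = pideal K (a / b)" "a \<in> ?S" "b \<in> ?S" unfolding eq by blast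
    hence c: "a / b \<in> intring K" using in_pideal_imp_in_intring[OF K I(1)] by blast
    have "(a - 1) - (a / b) * (b - 1) \<in> m" using ab mD(5)[OF _ mD(6)[OF c, of "b - 1"]] by blast
    also have "(a - 1) - (a / b) * (b - 1) = a / b - 1" using ab by (simp add: field_simps)
    finally show "\<exists>\<alpha>. I = pideal K \<alpha> \<and> \<alpha> - 1 \<in> m" using ab by blast
  next
    assume "\<exists>\<alpha>. I = pideal K \<alpha> \<and> \<alpha> - 1 \<in> m"
    then obtain \<alpha> where \<alpha>: "I = pideal K \<alpha>" "\<alpha> - 1 \<in> m" by blast
    have "\<alpha> \<in> intring K" using in_pideal_imp_in_intring[OF K I(1) \<alpha>(1)] .
    moreover have "\<alpha> \<noteq> 0"
        using I(2) \<alpha>(1) intring_closed(1)[OF K] by (auto simp: pideal_eq)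
    ultimately have "\<alpha> \<in> ?S" "1 \<in> ?S"
        using \<alpha>(2) mD(2) intring_closed(2)[OF K] by auto
    moreover have "I = pideal K (\<alpha> / 1)" using \<alpha> by simp
    ultimately show "I \<in> ray_subgroup K m" unfolding eq by blast
  qed
qed

text \<open>As for the ray subgroup, but with residues \<open>c\<close> and \<open>e\<close> of a
  and b: if \<open>u\<close> inverts \<open>e\<close> modulo \<open>f\<close>, then a/b is congruent
  to \<open>u * c\<close>, again an integer prime to \<open>f\<close>.\<close>

lemma mem_ring_subgroup_iff:
  assumes K: "subfield K CC" and I: "I \<subseteq> intring K" "I \<noteq> {0}"
  shows "I \<in> ring_subgroup K f \<longleftrightarrow>
    (\<exists>\<alpha>. I = pideal K \<alpha> \<and> (\<exists>c :: int. coprime c (int f) \<and> \<alpha> - of_int c \<in> pideal K (of_nat f)))"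
proof -
  let ?m = "pideal K (of_nat f)"
  let ?S = "{a \<in> intring K. a \<noteq> 0 \<and> (\<exists>c :: int. coprime c (int f) \<and> a - of_int c \<in> ?m)}"
  have m: "ideal ?m (ring_of_ints K)" by (intro ideal_pideal[OF K] intring_closed[OF K])
  note mD = idealD_ring_of_ints[OF m]
  have fm: "of_int (int f * z) \<in> ?m" for z
    using mD(7)[OF intring_closed(7)[OF K, of z] self_in_pideal[OF K, of "of_nat f"]] by simp
  have "ring_subgroup K f = generate (ideal_group K ?m) {pideal K a | a. a \<in> ?S}"
    by (simp add: ring_subgroup_def)
  also have "\<dots> = {pideal K (a / b) | a b. a \<in> ?S \<and> b \<in> ?S}"
  proof (rule generate_principal_ideals[OF K m])
    show "1 \<in> ?S" using mD(2) intring_closed(2)[OF K] by (auto intro!: exI[of _ 1])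
    show "a \<in> intring K \<and> a \<noteq> 0 \<and> comaximal K (pideal K a) ?m"
        if a: "a \<in> ?S" for a
    proof -
      from a obtain c where c: "coprime c (int f)" "a - of_int c \<in> ?m" by blast
      \<comment> \<open>Replacing \<open>c\<close> by \<open>a\<close> in this relation changes it
        by an element of the modulus, which gives comaximality.\<close>
      obtain u v where uv: "u * c + int f * v = 1"
        using bezout_int[of c "int f"] c(1) by (auto simp: coprime_iff_gcd_eq_1 mult.commute)
      have ua: "of_int u * a \<in> pideal K a" using intring_closed(7)[OF K] by (auto simp: pideal_eq)
      have "of_int (int f * v) - of_int u * (a - of_int c) \<in> ?m"
        by (rule mD(5)[OF fm mD(6)[OF intring_closed(7)[OF K] c(2)]])
      moreover have "of_int u * a + (of_int (int f * v) - of_int u * (a - of_int c)) = of_int (u * c + int f * v)"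
        by (simp add: algebra_simps)
      ultimately show ?thesis
        using a ua uv by (subst comaximal_iff[OF K ideal_pideal[OF K] m]) (auto intro!: bexI[OF _ ua])
    qed
    show "a * b \<in> ?S" if ab: "a \<in> ?S" "b \<in> ?S" for a b
    proof -
      from ab obtain c e where c: "coprime c (int f)" "a - of_int c \<in> ?m"
          and e: "coprime e (int f)" "b - of_int e \<in> ?m" by blast
      have "a * (b - of_int e) + of_int e * (a - of_int c) \<in> ?m"
        using ab mD(3)[OF mD(6)[OF _ e(2)] mD(6)[OF intring_closed(7)[OF K] c(2)]] by blast
      hence "a * b - of_int (c * e) \<in> ?m" by (simp add: algebra_simps)
      moreover have "coprime (c * e) (int f)" using c e by simp
      ultimately show ?thesis using ab by (auto simp: intring_closed[OF K] intro!: exI[of _ "c * e"])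
    qed
  qed
  finally have eq: "ring_subgroup K f = {pideal K (a / b) | a b. a \<in> ?S \<and> b \<in> ?S}" .
  show ?thesis
  proof
    assume "I \<in> ring_subgroup K f"
    then obtain a b where ab: "I = pideal K (a / b)" "a \<in> ?S" "b \<in> ?S" unfolding eq by blast
    hence q: "a / b \<in> intring K" using in_pideal_imp_in_intring[OF K I(1)] by blast
    from ab obtain c e where c: "coprime c (int f)" "a - of_int c \<in> ?m"
        and e: "coprime e (int f)" "b - of_int e \<in> ?m" by blast
    obtain u v where uv: "u * e + int f * v = 1"
      using bezout_int[of e "int f"] e(1) by (auto simp: coprime_iff_gcd_eq_1 mult.commute)
    \<comment> \<open>The bracket equals \<open>(a / b) * e - c\<close>; multiplying by
      \<open>u\<close> and adding the Bezout remainder turns the coefficient of a/b into 1.\<close>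
    let ?x = "of_int u * ((a - of_int c) - (a / b) * (b - of_int e)) + (a / b) * of_int (int f * v)"
    have "?x \<in> ?m"
      by (rule mD(3)[OF mD(6)[OF intring_closed(7)[OF K] mD(5)[OF c(2) mD(6)[OF q e(2)]]] mD(6)[OF q fm]])
    also have "?x = (a / b) * of_int (u * e + int f * v) - of_int (u * c)"
      using ab by (simp add: field_simps)
    finally have "a / b - of_int (u * c) \<in> ?m" unfolding uv by simp
    moreover have "coprime u (int f)"
      using uv by (metis coprime_iff_invertible_int cong_def mod_mult_self2)
    ultimately show "\<exists>\<alpha>. I = pideal K \<alpha> \<and> (\<exists>c :: int. coprime c (int f) \<and> \<alpha> - of_int c \<in> ?m)"
      using ab(1) c(1) by (intro exI[of _ "a / b"] conjI exI[of _ "u * c"]) auto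
  next
    assume "\<exists>\<alpha>. I = pideal K \<alpha> \<and> (\<exists>c :: int. coprime c (int f) \<and> \<alpha> - of_int c \<in> ?m)"
    then obtain \<alpha>
        where \<alpha>: "I = pideal K \<alpha>" "\<exists>c :: int. coprime c (int f) \<and> \<alpha> - of_int c \<in> ?m" by blast
    have "\<alpha> \<in> intring K" using in_pideal_imp_in_intring[OF K I(1) \<alpha>(1)] .
    moreover have "\<alpha> \<noteq> 0"
        using I(2) \<alpha>(1) intring_closed(1)[OF K] by (auto simp: pideal_eq)
    ultimately have "\<alpha> \<in> ?S" "1 \<in> ?S"
        using \<alpha>(2) mD(2) intring_closed(2)[OF K] by (auto intro!: exI[of _ 1])
    moreover have "I = pideal K (\<alpha> / 1)" using \<alpha> by simp
    ultimately show "I \<in> ring_subgroup K f" unfolding eq by blast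
  qed
qed

text \<open>The Artin homomorphism is part of \<open>class_field\<close>. It carries powers of
  \<open>p\<close> to powers of the symbol of \<open>p\<close>, so a power is trivial exactly when
  the ideal power lies in the kernel \<open>H\<close>.\<close>

lemma class_field_artin_pow:
  assumes K: "subfield K CC" and m: "ideal m (ring_of_ints K)" and cf: "class_field K m H L"
    and p: "p \<in> nonzero_primes K" "comaximal K p m"
  obtains \<rho> where "is_artin_symbol K L p \<rho>"
    "\<And>k :: nat. \<rho> [^]\<^bsub>Gal K L\<^esub> k = \<one>\<^bsub>Gal K L\<^esub> \<longleftrightarrow> ideal_pow K p k \<in> H"
proof -
  from cf obtain \<Phi>
      where \<Phi>: "\<Phi> \<in> hom (ideal_group K m) (Gal K L)" "is_artin_symbol K L p (\<Phi> p)"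
    "kernel (ideal_group K m) (Gal K L) \<Phi> = H" and "abelian_extension K L"
    using p by (auto simp: class_field_def)
  hence "comm_group (Gal K L)" by (simp add: abelian_extension_def)
  then interpret comm_group "Gal K L" .
  have idp: "ideal p (ring_of_ints K)" and "p \<noteq> {0}"
    using p(1) by (auto simp: nonzero_primes_def dest: primeideal.axioms(1))
  then obtain x where x: "x \<in> p" "x \<noteq> 0" using idealD_ring_of_ints(2)[OF idp] by auto
  have carr: "ideal_pow K p k \<in> carrier (ideal_group K m)" for k
    using neq_zero_ideal[OF power_in_ideal_pow[OF K x(1), of k]] x(2)
    by (intro integral_ideal_in_ideal_group[OF K m ideal_ideal_pow[OF K idp] _ comaximal_ideal_pow[OF K idp m p(2)]]) simp
  have pc: "p \<in> carrier (ideal_group K m)"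
    by (rule integral_ideal_in_ideal_group[OF K m idp \<open>p \<noteq> {0}\<close> p(2)])
  have hom: "\<Phi> (ideal_prod CC A B) = \<Phi> A \<otimes>\<^bsub>Gal K L\<^esub> \<Phi> B"
    if "A \<in> carrier (ideal_group K m)" "B \<in> carrier (ideal_group K m)" for A B
    using hom_mult[OF \<Phi>(1) that] by simp
  have closed: "\<Phi> A \<in> carrier (Gal K L)" if "A \<in> carrier (ideal_group K m)" for A
    using \<Phi>(1) that by (auto simp: hom_def)
  have pow: "\<Phi> (ideal_pow K p k) = \<Phi> p [^]\<^bsub>Gal K L\<^esub> k" for k :: nat
  proof (induction k)
    case 0
    \<comment> \<open>Membership in \<open>hom\<close> only gives multiplicativity, so the image of
      the unit ideal is recognized as the identity because it is idempotent.\<close>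
    have "intring K \<in> carrier (ideal_group K m)" using carr[of 0] by simp
    hence "\<Phi> (intring K) \<otimes>\<^bsub>Gal K L\<^esub> \<Phi> (intring K) = \<Phi> (intring K)" "\<Phi> (intring K) \<in> carrier (Gal K L)"
      using hom[of "intring K" "intring K"] ideal_group_ideal_prod_intring[OF K, of "intring K" m]
        closed[of "intring K"] by simp_all
    thus ?case by (simp add: l_cancel_one)
  next
    case (Suc k)
    thus ?case using hom[OF carr[of k] pc] by simp
  qed
  show ?thesis
    using \<Phi>(2) that[of "\<Phi> p"] pow carr unfolding \<Phi>(3)[symmetric] kernel_def by simp
qed

subsection \<open>Primes above and restriction of Artin symbols\<close>

text \<open>Zorn's lemma for the ideals that contain \<open>J\<close> and avoid
  \<open>\<one>\<close>; both properties survive unions of nonempty chains.\<close>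

lemma (in cring) exists_maximalideal:
  assumes "ideal J R" "\<one> \<notin> J"
  obtains M where "maximalideal M R" "J \<subseteq> M"
proof -
  define A where "A = {I. ideal I R \<and> J \<subseteq> I \<and> \<one> \<notin> I}"
  have "\<exists>N\<in>A. \<forall>Y\<in>A. N \<subseteq> Y \<longrightarrow> Y = N"
  proof (rule subset_Zorn_nonempty)
    show "A \<noteq> {}" using assms by (auto simp: A_def)
    fix C assume C: "C \<noteq> {}" "subset.chain A C"
    hence "subset.chain {I. ideal I R} C" by (auto simp: subset_chain_def A_def)
    hence "ideal (\<Union>C) R" using chain_Union_is_ideal[of C] C(1) by simp
    moreover have "C \<subseteq> A" using C(2) by (simp add: subset_chain_def)
    hence "J \<subseteq> \<Union>C" "\<one> \<notin> \<Union>C" using C(1) unfolding A_def by blast+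
    ultimately show "\<Union>C \<in> A" by (simp add: A_def)
  qed
  then obtain M where M: "M \<in> A" "\<And>Y. Y \<in> A \<Longrightarrow> M \<subseteq> Y \<Longrightarrow> Y = M" by blast
  have "maximalideal M R"
  proof (rule maximalidealI)
    show "ideal M R" "carrier R \<noteq> M" using M(1) by (auto simp: A_def)
    fix I assume I: "ideal I R" "M \<subseteq> I"
    show "I = M \<or> I = carrier R"
    proof (cases "\<one> \<in> I")
      case True
      thus ?thesis using ideal.one_imp_carrier[OF I(1)] by simp
    next
      case False
      thus ?thesis using M I by (auto simp: A_def)
    qed
  qed
  thus ?thesis using that M(1) by (auto simp: A_def)
qed

lemma primeidealD_ring_of_ints:
  assumes "primeideal P (ring_of_ints L)"
  shows "ideal P (ring_of_ints L)" "1 \<notin> P" "a \<in> intring L \<Longrightarrow> b \<in> intring L \<Longrightarrow> a * b \<in> P \<Longrightarrow> a \<in> P \<or> b \<in> P"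
proof -
  interpret primeideal P "ring_of_ints L" by (rule assms)
  show "ideal P (ring_of_ints L)" by (rule is_ideal)
  show "1 \<notin> P" using I_notcarr one_imp_carrier by auto
  show "a \<in> intring L \<Longrightarrow> b \<in> intring L \<Longrightarrow> a * b \<in> P \<Longrightarrow> a \<in> P \<or> b \<in> P" using I_prime[of a b] by simp
qed

lemma intring_mono: "K \<subseteq> L \<Longrightarrow> intring K \<subseteq> intring L"
  by (auto simp: mem_intring_iff)

lemma primeideal_contract:
  assumes M: "subfield M CC" and "M \<subseteq> L" and P: "primeideal P (ring_of_ints L)"
  shows "primeideal (P \<inter> M) (ring_of_ints M)"
proof -
  note PD = primeidealD_ring_of_ints[OF P]
  note I = idealD_ring_of_ints[OF PD(1)]
  have MO: "intring M \<subseteq> intring L" by (rule intring_mono[OF assms(2)])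
  have mult: "r * x \<in> P \<inter> M" if "r \<in> intring M" "x \<in> P \<inter> M" for r x
    using that I(6)[of r x] MO subfield_CC_closed(5)[OF M] by (auto simp: mem_intring_iff)
  have "ideal (P \<inter> M) (ring_of_ints M)"
  proof (rule ideal_ring_of_intsI[OF M])
    show "P \<inter> M \<subseteq> intring M" using I(1) by (auto simp: mem_intring_iff)
  qed (use I(2,3) subfield_CC_closed[OF M] mult in auto)
  thus ?thesis
  proof (rule primeidealI)
    show "cring (ring_of_ints M)" by (rule cring_ring_of_ints[OF M])
    show "intring M \<noteq> P \<inter> M" using PD(2) intring_closed(2)[OF M] by auto
    fix a b assume "a \<in> intring M" "b \<in> intring M" "a \<otimes>\<^bsub>ring_of_ints M\<^esub> b \<in> P \<inter> M"
    thus "a \<in> P \<inter> M \<or> b \<in> P \<inter> M"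
        using PD(3)[OF subsetD[OF MO] subsetD[OF MO], of a b] by (auto simp: mem_intring_iff)
  qed
qed

text \<open>The Frobenius congruence modulo \<open>P\<close> restricts to one modulo
  \<open>P \<inter> M\<close>, a prime of \<open>M\<close> above \<open>p\<close>, where uniqueness
  forces \<rho>. The given \<open>P\<close> keeps the definition of the symbol on \<open>L\<close>
  from being vacuous.\<close>

lemma artin_symbol_restrict:
  assumes L: "subfield L CC" and M: "galois_extension K M" and "M \<subseteq> L"
    and p: "p \<noteq> {0}" "p \<subseteq> K" and P: "P \<in> primes_above K L p"
    and \<tau>: "is_artin_symbol K L p \<tau>" and \<rho>: "is_artin_symbol K M p \<rho>"
  shows "restrict \<tau> M = \<rho>"
proof -
  from M have sM: "subfield M CC" and KM: "K \<subseteq> M" by (auto simp: galois_extension_def)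
  have prime: "primeideal P (ring_of_ints L)" and PK: "P \<inter> K = p"
    using P by (auto simp: primes_above_def nonzero_primes_def)
  have "p \<subseteq> P \<inter> M" using PK KM by blast
  hence "P \<inter> M \<noteq> {0}"
      using p(1) primeidealD_ring_of_ints(1)[OF prime] PK idealD_ring_of_ints(2)
    subfield_CC_closed(1)[OF sM] M subfield_CC_closed(1)[of K] by (auto simp: galois_extension_def)
  moreover have "(P \<inter> M) \<inter> K = p" using PK KM by blast
  ultimately have PM: "P \<inter> M \<in> primes_above K M p"
    using primeideal_contract[OF sM assms(3) prime] by (simp add: primes_above_def nonzero_primes_def)
  have frob: "frobenius_at K L p P \<tau>" using \<tau> P by (simp add: is_artin_symbol_def)
  hence \<tau>G: "\<tau> \<in> carrier (Gal K L)" by (simp add: frobenius_at_def)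
  have rG: "restrict \<tau> M \<in> carrier (Gal K M)" by (rule restrict_Gal[OF L M assms(3) \<tau>G])
  have "frobenius_at K M p (P \<inter> M) (restrict \<tau> M)"
    unfolding frobenius_at_def
  proof (intro conjI ballI)
    fix a assume a: "a \<in> intring M"
    hence aM: "a \<in> M" by (simp add: mem_intring_iff)
    have "\<tau> a - a ^ ideal_norm K p \<in> P"
      using frob a intring_mono[OF assms(3)] by (auto simp: frobenius_at_def)
    moreover have "a ^ n \<in> M" for n by (induction n) (auto simp: subfield_CC_closed[OF sM] aM)
    moreover have "\<tau> a \<in> M" by (rule Gal_maps_galois_subextension[OF L M assms(3) \<tau>G aM])
    ultimately show "restrict \<tau> M a - a ^ ideal_norm K p \<in> P \<inter> M"
      using aM subfield_CC_closed(6)[OF sM] by simp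
  qed (rule rG)
  thus ?thesis using \<rho> PM by (simp add: is_artin_symbol_def)
qed

lemma cnj_Rats: "a \<in> \<rat> \<Longrightarrow> cnj a = a"
  by (erule Rats_cases') simp

subsection \<open>Imaginary quadratic fields in which 3 splits\<close>

locale imag_quadratic =
  fixes d :: int and K :: "complex set"
  assumes d_pos: "d > 0" and K_eq: "K = quadratic_field (- d)"
begin

definition s :: complex where "s = csqrt (of_int (- d))"

lemma K: "subfield K CC"
  unfolding K_eq quadratic_field_def by (rule subfield_CC_generate_field)

lemma s_square: "s * s = of_int (- d)"
  unfolding s_def by (metis power2_csqrt power2_eq_square)

lemma cnj_s: "cnj s = - s"
  using d_pos by (simp add: s_def)

lemma s_in_K: "s \<in> K"
  unfolding K_eq quadratic_field_def s_def by (rule generate_field.incl) simp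

lemma s_in_intring: "s \<in> intring K"
  unfolding mem_intring_iff
proof
  show "algebraic_int s" unfolding s_def by (intro algebraic_int_csqrt int_imp_algebraic_int Ints_of_int)
qed (rule s_in_K)

lemma K_cases:
  assumes "x \<in> K"
  obtains a b where "a \<in> \<rat>" "b \<in> \<rat>" "x = a + b * s"
proof -
  have "x \<in> generate_field CC {s}" using assms by (simp add: K_eq quadratic_field_def s_def)
  hence "\<exists>a b. a \<in> \<rat> \<and> b \<in> \<rat> \<and> x = a + b * s"
  proof induction
    case one
    show ?case by (rule exI[of _ 1], rule exI[of _ 0]) simp
  next
    case (incl h)
    thus ?case by (intro exI[of _ 0] exI[of _ 1]) simp
  next
    case (a_inv h)
    then obtain a b where "a \<in> \<rat>" "b \<in> \<rat>" "h = a + b * s" by blast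
    thus ?case by (intro exI[of _ "- a"] exI[of _ "- b"]) simp
  next
    case (m_inv h)
    then obtain a b where ab: "a \<in> \<rat>" "b \<in> \<rat>" "h = a + b * s" by blast
    have h0: "h \<noteq> 0" using m_inv by simp
    \<comment> \<open>This is the norm \<open>h * cnj h\<close>, rational and nonzero, so
      rationalizing the denominator gives the coordinates of the inverse.\<close>
    let ?N = "a * a + b * b * of_int d"
    have N: "h * (a - b * s) = ?N" using s_square by (simp add: ab(3) algebra_simps)
    have "cnj h = a - b * s" using ab by (simp add: cnj_s cnj_Rats)
    hence "?N \<noteq> 0" using N h0 by (metis complex_cnj_zero_iff mult_eq_0_iff)
    hence "inverse h = (a - b * s) / ?N" using N h0 by (simp add: field_simps)
    hence "inverse h = a / ?N + (- b / ?N) * s" by (simp add: diff_divide_distrib)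
    moreover have "a / ?N \<in> \<rat>" "- b / ?N \<in> \<rat>"
        using ab by (intro Rats_divide Rats_add Rats_mult; simp)+
    ultimately have "\<exists>a b. a \<in> \<rat> \<and> b \<in> \<rat> \<and> inverse h = a + b * s"
        by blast
    thus ?case using h0 by simp
  next
    case (eng_add h1 h2)
    then obtain a b a' b'
        where "a \<in> \<rat>" "b \<in> \<rat>" "h1 = a + b * s" "a' \<in> \<rat>" "b' \<in> \<rat>" "h2 = a' + b' * s" by blast
    thus ?case by (intro exI[of _ "a + a'"] exI[of _ "b + b'"]) (simp add: algebra_simps)
  next
    case (eng_mult h1 h2)
    then obtain a b a' b'
        where ab: "a \<in> \<rat>" "b \<in> \<rat>" "h1 = a + b * s" "a' \<in> \<rat>" "b' \<in> \<rat>" "h2 = a' + b' * s" by blast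
    have "h1 * h2 = (a * a' + b * b' * (s * s)) + (a * b' + b * a') * s"
        using ab by (simp add: algebra_simps)
    thus ?case using ab unfolding s_square
        by (intro exI[of _ "a * a' + b * b' * of_int (- d)"] exI[of _ "a * b' + b * a'"]) auto
  qed
  thus ?thesis using that by blast
qed

lemma cnj_in_K: assumes "x \<in> K"
    shows "cnj x \<in> K" "x + cnj x \<in> \<rat>" "x * cnj x \<in> \<rat>"
proof -
  obtain a b where ab: "a \<in> \<rat>" "b \<in> \<rat>" "x = a + b * s" using K_cases[OF assms] .
  have RK: "r \<in> K" if "r \<in> \<rat>" for r
    using that by (auto elim!: Rats_cases' simp: subfield_CC_closed[OF K])
  have c: "cnj x = a - b * s" using ab by (simp add: cnj_Rats cnj_s)
  show "cnj x \<in> K" unfolding c using ab s_in_K by (auto simp: RK subfield_CC_closed[OF K])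
  have "x + cnj x = a + a" unfolding c using ab(3) by simp
  moreover have "a + a \<in> \<rat>" using ab by (intro Rats_add)
  ultimately show "x + cnj x \<in> \<rat>" by simp
  have "x * cnj x = a * a - b * b * (s * s)" unfolding c using ab(3) by (simp add: algebra_simps)
  moreover have "a * a - b * b * of_int (- d) \<in> \<rat>"
      using ab by (intro Rats_diff Rats_mult Rats_of_int)
  ultimately show "x * cnj x \<in> \<rat>" by (simp add: s_square)
qed

lemma cnj_in_intring: "x \<in> intring K \<Longrightarrow> cnj x \<in> intring K"
  by (auto simp: mem_intring_iff cnj_in_K)

lemma intring_trace: "x \<in> intring K \<Longrightarrow> x + cnj x \<in> \<int>"
  using intring_closed(3)[OF K _ cnj_in_intring, of x x] cnj_in_K(2)[of x]
  by (auto simp: mem_intring_iff intro: rational_algebraic_int_is_int)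

lemma intring_norm: "x \<in> intring K \<Longrightarrow> x * cnj x \<in> \<int>"
  using intring_closed(5)[OF K _ cnj_in_intring, of x x] cnj_in_K(3)[of x]
  by (auto simp: mem_intring_iff intro: rational_algebraic_int_is_int)

end

section \<open>Divisibility by powers of the primes above 3\<close>

lemma ideal_prod_CC_left_commute: "ideal_prod CC I (ideal_prod CC J M) = ideal_prod CC J (ideal_prod CC I M)"
  by (metis ideal_prod_CC_assoc ideal_prod_CC_commute)

lemmas ideal_prod_CC_ac = ideal_prod_CC_assoc ideal_prod_CC_commute ideal_prod_CC_left_commute

lemma ideal_prod_CC_subset_left:
  assumes "ideal I (ring_of_ints K)" "J \<subseteq> intring K"
  shows "ideal_prod CC I J \<subseteq> I"
  by (rule ideal_prod_CC_subset) (use idealD_ring_of_ints[OF assms(1)] assms(2) in auto)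

lemma ideal_pow_antimono:
  assumes K: "subfield K CC" and I: "ideal I (ring_of_ints K)" and "j \<le> k"
  shows "ideal_pow K I k \<subseteq> ideal_pow K I j"
  using assms(3)
proof (induction k rule: dec_induct)
  case (step k)
  have "ideal_pow K I (Suc k) \<subseteq> ideal_pow K I k"
    using ideal_prod_CC_subset_left[OF ideal_ideal_pow[OF K I] idealD_ring_of_ints(1)[OF I]] by simp
  thus ?case using step by blast
qed simp

lemma ideal_pow_ideal_prod:
  assumes K: "subfield K CC"
  shows "ideal_prod CC (ideal_pow K I k) (ideal_pow K J k) = ideal_pow K (ideal_prod CC I J) k"
proof (induction k)
  case 0
  show ?case by (simp add: ideal_prod_CC_intring intring_closed[OF K])
next
  case (Suc k)
  show ?case by (simp add: Suc.IH[symmetric] ideal_prod_CC_ac)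
qed

lemma ideal_pow_pideal:
  assumes K: "subfield K CC"
  shows "ideal_pow K (pideal K a) k = pideal K (a ^ k)"
  by (induction k) (simp_all add: pideal_1 ideal_prod_pideal[OF K] mult.commute)

lemma pideal_uminus: "subfield K CC \<Longrightarrow> pideal K (- a) = pideal K a"
  unfolding pideal_eq
      by (auto simp: image_iff) (metis intring_closed(4) minus_minus mult_minus_left mult_minus_right)+

text \<open>A quotient of integers that is an algebraic integer is an integer; this brings
  divisibility among algebraic integers down to the integers.\<close>

lemma complex_of_int_dvd:
  assumes "of_int x = of_int a * (w :: complex)" "algebraic_int w"
  shows "a dvd x"
proof (cases "a = 0")
  case False
  hence "w = of_int x / of_int a" using assms(1) by simp
  hence "w \<in> \<rat>" by simp
  hence "w \<in> \<int>" using rational_algebraic_int_is_int assms(2) by blast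
  then obtain z where "w = of_int z" by (auto elim: Ints_cases)
  hence "x = a * z" using assms(1) by (metis of_int_eq_iff of_int_mult)
  thus ?thesis by simp
qed (use assms in simp)

locale three_splits = imag_quadratic +
  fixes p p' :: "complex set"
  assumes p: "p \<in> nonzero_primes K" and p': "p' \<in> nonzero_primes K"
    and p'_eq: "p' = cnj ` p"
    and pp': "pideal K 3 = ideal_prod CC p p'"
    and d_mod: "[- d = 1] (mod 3)"
begin

lemma prime_p: "primeideal p (ring_of_ints K)" "p \<noteq> {0}"
  and prime_p': "primeideal p' (ring_of_ints K)"
  using p p' by (auto simp: nonzero_primes_def)

lemmas pI = primeidealD_ring_of_ints(1)[OF prime_p(1)]
lemmas pI' = primeidealD_ring_of_ints(1)[OF prime_p']
lemmas pD = idealD_ring_of_ints[OF pI]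
lemmas pD' = idealD_ring_of_ints[OF pI']

lemma cnj_p: "x \<in> p \<longleftrightarrow> cnj x \<in> p'"
    and cnj_p': "x \<in> p' \<longleftrightarrow> cnj x \<in> p"
  unfolding p'_eq by (auto simp: image_iff) (metis complex_cnj_cnj)+

lemma three_in: "3 \<in> p" "3 \<in> p'"
proof -
  have 3: "3 \<in> ideal_prod CC p p'" using self_in_pideal[OF K, of 3] by (simp add: pp')
  show "3 \<in> p" using ideal_prod_CC_subset_left[OF pI pD'(1)] 3 by blast
  show "3 \<in> p'"
      using ideal_prod_CC_subset_left[OF pI' pD(1)] 3 by (subst (asm) ideal_prod_CC_commute) blast
qed

text \<open>Since \<open>-d \<equiv> 1\<close> modulo 3, the product \<open>(s - 1) (s + 1)\<close> lies in \<open>p\<close>, and adding to the factor in \<open>p\<close>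
  its conjugate in \<open>p'\<close> gives \<open>\<plusminus>2\<close>.\<close>
lemma comaximal_p_p': "comaximal K p p'"
proof -
  obtain e where e: "- d - 1 = 3 * e" using d_mod by (auto simp: cong_iff_dvd_diff)
  have "(s - 1) * (s + 1) = of_int (- d - 1)" using s_square by (simp add: algebra_simps)
  also have "\<dots> = of_int e * 3" unfolding e by simp
  finally have "(s - 1) * (s + 1) \<in> p" using pD(6)[OF intring_closed(7)[OF K] three_in(1)] by metis
  hence "s - 1 \<in> p \<or> s + 1 \<in> p"
    using primeidealD_ring_of_ints(3)[OF prime_p(1), of "s - 1" "s + 1"] s_in_intring intring_closed[OF K] by simp
  then obtain c :: complex where c: "c = 1 \<or> c = -1" "s - c \<in> p" by (metis diff_minus_eq_add)
  have "- s - c \<in> p'" using c by (auto simp: cnj_p cnj_s)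
  moreover have "c \<in> intring K" using c(1) intring_closed[OF K] by auto
  ultimately have "c * (- s - c) \<in> p'" "c * (s - c) \<in> p" using pD'(6) pD(6) c(2) by blast+
  \<comment> \<open>The two multiples add up to \<open>-2 * c * c = -2\<close>, and the element 3 of
    \<open>p\<close> corrects this to 1.\<close>
  moreover have "c * c = 1" using c(1) by auto
  hence "(c * (s - c) + 3) + c * (- s - c) = 1" by (simp add: algebra_simps)
  ultimately show ?thesis
    using pD(3)[OF _ three_in(1)] by (subst comaximal_iff[OF K pI pI']) blast
qed

lemma ideal_pow_p_p': "ideal_prod CC (ideal_pow K p k) (ideal_pow K p' k) = pideal K (3 ^ k)"
  by (simp add: ideal_pow_ideal_prod[OF K] pp'[symmetric] ideal_pow_pideal[OF K])

lemma cnj_ideal_pow: "x \<in> ideal_pow K p k \<Longrightarrow> cnj x \<in> ideal_pow K p' k"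
  "x \<in> ideal_pow K p' k \<Longrightarrow> cnj x \<in> ideal_pow K p k"
proof -
  have *: "x \<in> ideal_pow K I k \<Longrightarrow> cnj x \<in> ideal_pow K J k"
      if IJ: "\<And>x. x \<in> I \<Longrightarrow> cnj x \<in> J" for I J x
  proof (induction k arbitrary: x)
    case (Suc k)
    have "x \<in> ideal_prod CC (ideal_pow K I k) I" using Suc.prems by simp
    hence "cnj x \<in> ideal_prod CC (ideal_pow K J k) J"
      by induction (auto simp: Suc.IH IJ intro: ideal_prod_CC_prod ideal_prod_CC_add)
    thus ?case by simp
  qed (simp add: cnj_in_intring)
  show "x \<in> ideal_pow K p k \<Longrightarrow> cnj x \<in> ideal_pow K p' k" using * cnj_p by blast
  show "x \<in> ideal_pow K p' k \<Longrightarrow> cnj x \<in> ideal_pow K p k" using * cnj_p' by blast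
qed

lemma comaximal_pow: "comaximal K (ideal_pow K p j) (ideal_pow K p' k)"
proof -
  have "comaximal K (ideal_pow K p j) p'" by (rule comaximal_ideal_pow[OF K pI pI' comaximal_p_p'])
  hence "comaximal K p' (ideal_pow K p j)"
      using comaximal_commute[OF K ideal_ideal_pow[OF K pI] pI'] by blast
  hence "comaximal K (ideal_pow K p' k) (ideal_pow K p j)"
    by (rule comaximal_ideal_pow[OF K pI' ideal_ideal_pow[OF K pI]])
  thus ?thesis using comaximal_commute[OF K ideal_ideal_pow[OF K pI] ideal_ideal_pow[OF K pI']] by blast
qed

text \<open>An integer is its own conjugate, so it lies in the k-th powers of both \<open>p\<close>
  and \<open>p'\<close>. Comaximality puts it into their product, which is generated by
  \<open>3 ^ k\<close>.\<close>

lemma int_in_ideal_pow: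
  assumes "of_int x \<in> ideal_pow K p' k"
  shows "3 ^ k dvd x"
proof -
  let ?x = "of_int x :: complex"
  have x: "?x \<in> ideal_pow K p k" using cnj_ideal_pow(2)[OF assms] by simp
  obtain u v where uv: "u \<in> ideal_pow K p k" "v \<in> ideal_pow K p' k" "u + v = 1"
    using comaximal_pow[of k k] comaximal_iff[OF K ideal_ideal_pow[OF K pI] ideal_ideal_pow[OF K pI']]
        by blast
  have "u * ?x + ?x * v \<in> ideal_prod CC (ideal_pow K p k) (ideal_pow K p' k)"
    by (intro ideal_prod_CC_add ideal_prod_CC_prod uv x assms)
  also have "u * ?x + ?x * v = ?x" using uv(3) by (metis distrib_left mult.commute mult.right_neutral)
  finally obtain w where w: "w \<in> intring K" "?x = w * 3 ^ k"
    unfolding ideal_pow_p_p' pideal_eq by blast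
  hence "?x = of_int (3 ^ k) * w" by (simp add: mult.commute)
  thus ?thesis using complex_of_int_dvd w(1) by (simp add: mem_intring_iff)
qed

text \<open>Norms of elements of \<open>Q\<close> are divisible by 3, since otherwise Bezout with 3
  puts 1 into \<open>Q\<close>. Hence \<open>Q\<close> is contained in the union of \<open>p\<close>
  and \<open>p'\<close>, and the last part shows that it cannot meet the complement of
  \<open>p\<close>.\<close>

lemma prime_over_p_unique:
  assumes Q: "primeideal Q (ring_of_ints K)" and "p \<subseteq> Q"
  shows "Q = p"
proof -
  note QD = primeidealD_ring_of_ints[OF Q]
  note QI = idealD_ring_of_ints[OF QD(1)]
  have union: "x \<in> p \<or> x \<in> p'" if "x \<in> Q" for x
  proof -
    have xO: "x \<in> intring K" using that QI(1) by blast
    obtain n where n: "x * cnj x = of_int n" using intring_norm[OF xO] by (auto elim: Ints_cases)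
    have nQ: "of_int n \<in> Q" using QI(7)[OF cnj_in_intring[OF xO] that] n by simp
    have "3 dvd n"
    proof (rule ccontr)
      assume "\<not> 3 dvd n"
      hence "coprime 3 n" by (intro prime_imp_coprime) auto
      then obtain a b where ab: "a * 3 + b * n = 1"
        using bezout_int[of 3 n] by (auto simp: coprime_iff_gcd_eq_1)
      have "of_int a * 3 + of_int b * of_int n \<in> Q"
        using three_in(1) assms(2) by (intro QI(3) QI(6) nQ intring_closed(7)[OF K]) auto
      moreover have "of_int a * 3 + of_int b * of_int n = (of_int (a * 3 + b * n) :: complex)" by simp
      ultimately show False using QD(2) unfolding ab by simp
    qed
    then obtain e where "n = e * 3" by (metis dvd_def mult.commute)
    hence "x * cnj x \<in> p" using n pD(6)[OF intring_closed(7)[OF K] three_in(1), of e] by simp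
    hence "x \<in> p \<or> cnj x \<in> p"
      using primeidealD_ring_of_ints(3)[OF prime_p(1) xO cnj_in_intring[OF xO]] by blast
    thus ?thesis by (simp add: cnj_p')
  qed
  \<comment> \<open>Prime avoidance: for \<open>x\<close> in \<open>Q\<close> outside
    \<open>p\<close>, both \<open>x\<close> and \<open>x + u\<close> are forced into
    \<open>p'\<close>, hence so are \<open>u\<close> and finally 1.\<close>
  obtain u v where uv: "u \<in> p" "v \<in> p'" "u + v = 1"
    using comaximal_p_p' comaximal_iff[OF K pI pI'] by blast
  have "x \<in> p" if x: "x \<in> Q" for x
  proof (rule ccontr)
    assume xp: "x \<notin> p"
    hence xp': "x \<in> p'" using union x by blast
    have "x + u \<in> Q" using QI(3)[OF x] uv(1) assms(2) by blast
    moreover have "x + u \<notin> p" using pD(5)[of "x + u" u] uv(1) xp by auto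
    ultimately have "x + u \<in> p'" using union by blast
    hence "u \<in> p'" using pD'(5)[OF _ xp'] by (metis add_diff_cancel_left')
    hence "1 \<in> p'" using pD'(3)[OF _ uv(2), of u] uv(3) by simp
    thus False using primeidealD_ring_of_ints(2)[OF prime_p'] by blast
  qed
  thus ?thesis using assms(2) by blast
qed

text \<open>If 1 were a combination of elements of \<open>p\<close> over the integers of
  \<open>L\<close>, multiplying by \<open>a \<in> p'\<close> would make \<open>a\<close> divisible
  by 3, first over \<open>L\<close> and then over \<open>K\<close>. So the product of
  \<open>p\<close> and \<open>p'\<close>, which contains 3, would lie in 3 times \<open>p\<close>,
  giving 1 in \<open>p\<close>.\<close>

lemma one_notin_extended_ideal:
  assumes L: "subfield L CC" and "K \<subseteq> L"
  shows "1 \<notin> ideal_prod CC (intring L) p"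
proof
  assume one: "1 \<in> ideal_prod CC (intring L) p"
  have KO: "intring K \<subseteq> intring L" by (rule intring_mono[OF assms(2)])
  have div3: "\<exists>w\<in>intring K. a = 3 * w" if a: "a \<in> p'" for a
  proof -
    \<comment> \<open>Generalized from 1 to every \<open>z\<close> of the extended ideal so that
      induction over sums of products applies.\<close>
    have "\<exists>w\<in>intring L. a * z = 3 * w" if "z \<in> ideal_prod CC (intring L) p" for z
      using that
    proof induction
      case (prod r i)
      have "i * a \<in> pideal K 3" unfolding pp' by (rule ideal_prod_CC_prod[OF prod(2) a])
      then obtain w where "w \<in> intring K" "i * a = w * 3" by (auto simp: pideal_eq)
      hence "a * (r * i) = 3 * (r * w)" "r * w \<in> intring L"
        using KO prod(1) intring_closed(5)[OF L] by (auto simp: algebra_simps)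
      thus ?case unfolding CC_simps by blast
    next
      case (sum z1 z2)
      then obtain w1 w2
          where "w1 \<in> intring L" "w2 \<in> intring L" "a * z1 = 3 * w1" "a * z2 = 3 * w2" by blast
      thus ?case using intring_closed(3)[OF L, of w1 w2]
          by (intro bexI[of _ "w1 + w2"]) (auto simp: algebra_simps)
    qed
    from this[OF one] obtain w where w: "w \<in> intring L" "a = 3 * w" by auto
    have "a \<in> K" using a pD'(1) by (auto simp: mem_intring_iff)
    hence "a / of_int 3 \<in> K" by (intro subfield_CC_closed[OF K])
    hence "w \<in> K" using w(2) by simp
    thus ?thesis using w by (auto simp: mem_intring_iff)
  qed
  have "ideal_prod CC p p' \<subseteq> (\<lambda>x. 3 * x) ` p"
  proof (rule ideal_prod_CC_subset)
    fix i j assume "i \<in> p" "j \<in> p'"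
    then obtain w where "w \<in> intring K" "j = 3 * w" using div3 by blast
    hence "i * j = 3 * (i * w)" "i * w \<in> p" using pD(7)[of w i] \<open>i \<in> p\<close> by simp_all
    thus "i * j \<in> (\<lambda>x. 3 * x) ` p" by (rule image_eqI)
  next
    fix x y assume "x \<in> (\<lambda>x. 3 * x) ` p" "y \<in> (\<lambda>x. 3 * x) ` p"
    then obtain u v where "u \<in> p" "v \<in> p" "x = 3 * u" "y = 3 * v" by blast
    hence "x + y = 3 * (u + v)" "u + v \<in> p" using pD(3) by simp_all
    thus "x + y \<in> (\<lambda>x. 3 * x) ` p" by (rule image_eqI)
  qed
  hence "3 \<in> (\<lambda>x. 3 * x) ` p" using self_in_pideal[OF K, of 3] unfolding pp' by blast
  thus False using primeidealD_ring_of_ints(2)[OF prime_p(1)] by auto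
qed

text \<open>A maximal ideal over the extension of \<open>p\<close> contracts to a prime of
  \<open>K\<close> containing \<open>p\<close>, hence to \<open>p\<close> itself.\<close>

lemma primes_above_nonempty:
  assumes L: "subfield L CC" and KL: "K \<subseteq> L"
  obtains P where "P \<in> primes_above K L p"
proof -
  interpret cring "ring_of_ints L" by (rule cring_ring_of_ints[OF L])
  let ?J = "ideal_prod CC (intring L) p"
  have KO: "intring K \<subseteq> intring L" by (rule intring_mono[OF KL])
  have J: "ideal ?J (ring_of_ints L)"
  proof (rule ideal_ring_of_intsI[OF L])
    show "?J \<subseteq> intring L"
      by (rule ideal_prod_CC_subset) (use pD(1) KO intring_closed[OF L] in auto)
    show "0 \<in> ?J" using ideal_prod_CC_prod[OF intring_closed(1)[OF L] pD(2)] by simp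
    show "r * x \<in> ?J" if "r \<in> intring L" "x \<in> ?J" for r x
      using that(2)
    proof induction
      case (prod i j)
      have "(r * i) * j \<in> ?J" using prod that(1) by (intro ideal_prod_CC_prod intring_closed[OF L])
      thus ?case by (simp add: mult.assoc)
    qed (simp add: distrib_left ideal_prod_CC_add)
  qed (rule ideal_prod_CC_add)
  then obtain P where P: "maximalideal P (ring_of_ints L)" "?J \<subseteq> P"
    using exists_maximalideal[of ?J] one_notin_extended_ideal[OF L KL] by auto
  have prime: "primeideal P (ring_of_ints L)" by (rule maximalideal_prime[OF P(1)])
  have "p \<subseteq> ?J" using ideal_prod_CC_prod[OF intring_closed(2)[OF L], of _ p] by fastforce
  hence pP: "p \<subseteq> P" using P(2) by blast
  moreover have "p \<subseteq> K" using pD(1) by (auto simp: mem_intring_iff)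
  ultimately have "P \<inter> K = p"
    by (intro prime_over_p_unique primeideal_contract[OF K KL prime]) auto
  moreover have "P \<noteq> {0}" using pP prime_p(2) pD(2) by blast
  ultimately show ?thesis using that prime by (auto simp: primes_above_def nonzero_primes_def)
qed

end

section \<open>Units, the order of conductor f, and traces\<close>

lemma int_square_cases: "z * z = 0 \<or> z * z = 1 \<or> z * z \<ge> 4" for z :: int
proof (cases "\<bar>z\<bar> \<le> 1")
  case True
  hence "z = 0 \<or> z = 1 \<or> z = - 1" by linarith
  thus ?thesis by auto
next
  case False
  hence "2 * 2 \<le> \<bar>z\<bar> * \<bar>z\<bar>" by (intro mult_mono) auto
  thus ?thesis by simp
qed

locale three_splits_order = three_splits +
  fixes dK :: int and f :: nat
  assumes disc: "imag_quadratic_disc K dK" and f_pos: "f > 0" and d_eq: "- d = dK * int f ^ 2"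
begin

text \<open>If 3 divided \<open>f\<close>, it would divide -d. Otherwise the square of
  \<open>f\<close> is 1 modulo 3, so \<open>dK\<close> has the same residue as -d.\<close>

lemma coprime_3_f: "coprime 3 (int f)" and dK_mod: "[dK = 1] (mod 3)" and dK_neg: "dK < 0"
proof -
  have nf: "\<not> 3 dvd int f"
  proof
    assume "3 dvd int f"
    hence "3 dvd - d" unfolding d_eq by (simp add: power2_eq_square)
    thus False using d_mod by (auto simp: cong_def dvd_eq_mod_eq_0)
  qed
  thus "coprime 3 (int f)" by (intro prime_imp_coprime) auto
  have "int f mod 3 = 1 \<or> int f mod 3 = 2" using nf by presburger
  hence "[int f ^ 2 = 1] (mod 3)"
    by (auto simp: cong_def power_mod[symmetric, of "int f"])
  hence "[dK * int f ^ 2 = dK * 1] (mod 3)" by (rule cong_scalar_left)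
  thus "[dK = 1] (mod 3)" using d_mod unfolding d_eq by (metis cong_sym cong_trans mult.right_neutral)
  have "dK * int f ^ 2 < 0" using d_pos d_eq by simp
  thus "dK < 0" by (simp add: mult_less_0_iff)
qed

text \<open>\<delta> is the determinant of the integral basis in the definition of the discriminant.
  Twice \<open>w\<close> is its trace plus \<open>w - cnj w\<close>, and the latter is an
  alternating form in \<open>w\<close> and 1, hence an integer multiple of \<delta>.\<close>

lemma intring_coords:
  obtains \<delta> where "\<delta> * \<delta> = of_int dK" "cnj \<delta> = - \<delta>"
    "\<And>w. w \<in> intring K \<Longrightarrow> \<exists>t m :: int. w = (of_int t + of_int m * \<delta>) / 2"
proof -
  obtain w1 w2 where bij: "bij_betw (\<lambda>(a :: int, b :: int). of_int a * w1 + of_int b * w2) UNIV (intring K)"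
    and D: "of_int dK = (w1 * cnj w2 - w2 * cnj w1)\<^sup>2"
    using disc by (auto simp: imag_quadratic_disc_def)
  define \<delta> where "\<delta> = w1 * cnj w2 - w2 * cnj w1"
  have coord: "\<exists>a b :: int. w = of_int a * w1 + of_int b * w2" if "w \<in> intring K" for w
  proof -
    have "w \<in> range (\<lambda>(a :: int, b :: int). of_int a * w1 + of_int b * w2)"
      using that bij_betw_imp_surj_on[OF bij] by simp
    thus ?thesis by auto
  qed
  obtain a b :: int where one: "1 = of_int a * w1 + of_int b * w2"
      using coord[OF intring_closed(2)[OF K]] by blast
  have one': "1 = of_int a * cnj w1 + of_int b * cnj w2"
    using arg_cong[OF one, of cnj] by simp
  have "\<exists>t m :: int. w = (of_int t + of_int m * \<delta>) / 2" if w: "w \<in> intring K" for w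
  proof -
    obtain u v :: int where uv: "w = of_int u * w1 + of_int v * w2" using coord[OF w] by blast
    obtain t where t: "w + cnj w = of_int t" using intring_trace[OF w] by (auto elim: Ints_cases)
    \<comment> \<open>The factors 1 are inserted in order to expand them in the basis; the mixed
      terms then assemble into a 2 by 2 determinant times \<delta>.\<close>
    have "w - cnj w = w * 1 - cnj w * 1" by simp
    also have "\<dots> = w * (of_int a * cnj w1 + of_int b * cnj w2) - cnj w * (of_int a * w1 + of_int b * w2)"
      using one one' by metis
    also have "\<dots> = of_int (u * b - v * a) * \<delta>" by (simp add: uv \<delta>_def algebra_simps)
    finally have diff: "w - cnj w = of_int (u * b - v * a) * \<delta>" .
    have "2 * w = (w + cnj w) + (w - cnj w)" by simp
    also have "\<dots> = of_int t + of_int (u * b - v * a) * \<delta>" by (simp only: t diff)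
    finally have "w = (of_int t + of_int (u * b - v * a) * \<delta>) / 2" by (simp add: mult.commute)
    thus ?thesis by blast
  qed
  moreover have "\<delta> * \<delta> = of_int dK" "cnj \<delta> = - \<delta>"
      using D by (simp_all add: \<delta>_def power2_eq_square)
  ultimately show ?thesis using that by blast
qed

text \<open>\<open>d\<^sub>K \<equiv> 1\<close> modulo 3 excludes the discriminants \<open>-3\<close> and \<open>-4\<close> of the fields with extra units.\<close>
lemma intring_units:
  assumes "u \<in> intring K" "v \<in> intring K" "u * v = 1"
  shows "u = 1 \<or> u = - 1"
proof -
  obtain \<delta> where \<delta>: "\<delta> * \<delta> = of_int dK" "cnj \<delta> = - \<delta>"
    "\<And>w. w \<in> intring K \<Longrightarrow> \<exists>t m :: int. w = (of_int t + of_int m * \<delta>) / 2"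
    by (rule intring_coords) blast
  obtain t m :: int where tm: "u = (of_int t + of_int m * \<delta>) / 2"
      using \<delta>(3)[OF assms(1)] by blast
  obtain a where a: "u * cnj u = of_int a" using intring_norm[OF assms(1)] by (auto elim: Ints_cases)
  obtain b where b: "v * cnj v = of_int b" using intring_norm[OF assms(2)] by (auto elim: Ints_cases)
  have "of_int (a * b) = (u * v) * cnj (u * v)" by (simp add: a[symmetric] b[symmetric])
  hence "a * b = 1" unfolding assms(3) by (simp flip: of_int_mult)
  \<comment> \<open>\<open>a\<close> is a squared absolute value, which excludes the factorization
    (-1) * (-1) of 1.\<close>
  moreover have "a \<ge> 0"
  proof -
    have "of_int a = (of_real ((cmod u)\<^sup>2) :: complex)" using a complex_norm_square[of u] by simp
    hence "real_of_int a = (cmod u)\<^sup>2" by (metis of_real_eq_iff of_real_of_int_eq)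
    thus ?thesis by (metis of_int_0_le_iff zero_le_power2)
  qed
  ultimately have "a = 1" using zmult_eq_1_iff[of a b] by auto
  have "4 * (u * cnj u) = of_int t * of_int t - of_int m * of_int m * (\<delta> * \<delta>)"
    by (simp add: tm \<delta>(2) field_simps)
  hence "of_int 4 = (of_int (t * t - m * m * dK) :: complex)"
      unfolding a \<open>a = 1\<close> \<delta>(1) by simp
  hence eq: "4 = t * t - m * m * dK" by (simp only: of_int_eq_iff)
  have "m = 0"
  proof (rule ccontr)
    assume "m \<noteq> 0"
    hence m1: "m * m \<ge> 1"
        by (metis int_one_le_iff_zero_less not_real_square_gt_zero zero_less_mult_iff linorder_neqE_linordered_idom)
    have tt: "t * t \<ge> 0" by simp
    have "- dK \<le> - (m * m * dK)" using m1 dK_neg by (simp add: mult_le_cancel_right1)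
    hence "- dK \<le> 4" using eq tt by linarith
    \<comment> \<open>Of the values -4, ..., -1 only -2 is 1 modulo 3. It is excluded by the norm
      equation, since \<open>t * t + 2 * (m * m) = 4\<close> with \<open>m\<close> nonzero would
      need a square equal to 2 or a left side of at least 8.\<close>
    hence "dK = -2" using dK_neg dK_mod by (auto simp: cong_def) presburger
    hence "t * t + 2 * (m * m) = 4" using eq by simp
    thus False using m1 int_square_cases[of t] int_square_cases[of m] by linarith
  qed
  hence "t * t = 4" using eq by simp
  hence "(t - 2) * (t + 2) = 0" by (simp add: algebra_simps)
  hence "t = 2 \<or> t = - 2" by auto
  thus ?thesis using tm \<open>m = 0\<close> by auto
qed

text \<open>Both \<open>of_nat f * \<delta>\<close> and \<open>s\<close> are square roots of -d, so
  they agree up to a sign \<open>e\<close>, which is absorbed into \<open>y\<close>.\<close>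

lemma quadratic_order_coords:
  assumes "\<alpha> \<in> quadratic_order K f"
  obtains x y :: int where "\<alpha> = (of_int x + of_int y * csqrt (of_int (- d))) / 2"
proof -
  obtain \<delta> where \<delta>: "\<delta> * \<delta> = of_int dK"
    "\<And>w. w \<in> intring K \<Longrightarrow> \<exists>t m :: int. w = (of_int t + of_int m * \<delta>) / 2"
    by (rule intring_coords) blast
  obtain a w where aw: "\<alpha> = of_int a + of_nat f * w" "w \<in> intring K"
    using assms by (auto simp: quadratic_order_def)
  obtain t m :: int where tm: "w = (of_int t + of_int m * \<delta>) / 2"
      using \<delta>(2)[OF aw(2)] by blast
  have "(of_nat f * \<delta>) * (of_nat f * \<delta>) = of_nat f * of_nat f * (\<delta> * \<delta>)"
      by (simp add: algebra_simps)
  also have "\<dots> = of_int (dK * int f ^ 2)" unfolding \<delta>(1)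
      by (simp add: power2_eq_square algebra_simps)
  also have "\<dots> = s * s" unfolding d_eq[symmetric] s_square ..
  finally have "of_nat f * \<delta> = s \<or> of_nat f * \<delta> = - s" by (simp only: square_eq_iff)
  then obtain e :: int where e: "of_nat f * \<delta> = of_int e * s"
    by (elim disjE) (force intro: that[of 1], metis mult_minus1 of_int_1 of_int_minus)
  have "\<alpha> = (of_int (2 * a + int f * t) + of_int m * (of_nat f * \<delta>)) / 2"
    by (simp add: aw tm field_simps)
  also have "\<dots> = (of_int (2 * a + int f * t) + of_int (m * e) * csqrt (of_int (- d))) / 2"
    unfolding e by (simp add: s_def)
  finally show ?thesis using that by blast
qed

text \<open>The left side provides two generators, one per subgroup; merging them costs a unit,
  which is the source of the two signs on the right. In the converse the point is that the integer
  part of \<alpha> is prime to \<open>f\<close>.\<close>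

lemma ideal_pow_p_in_class_subgroups_iff:
  "ideal_pow K p k \<in> ray_subgroup K (ideal_pow K p' 2) \<and> ideal_pow K p k \<in> ring_subgroup K f \<longleftrightarrow>
   (\<exists>\<alpha>\<in>quadratic_order K f. ideal_pow K p k = pideal K \<alpha> \<and>
      (\<alpha> - 1 \<in> ideal_pow K p' 2 \<or> \<alpha> + 1 \<in> ideal_pow K p' 2))"
  (is "?L \<longleftrightarrow> ?R")
proof -
  let ?I = "ideal_pow K p k" and ?m = "ideal_pow K p' 2"
  have I: "?I \<subseteq> intring K" using idealD_ring_of_ints(1)[OF ideal_ideal_pow[OF K pI]] .
  have 3: "3 ^ k \<in> ?I" by (rule power_in_ideal_pow[OF K three_in(1)])
  have I0: "?I \<noteq> {0}" by (rule neq_zero_ideal[OF 3]) simp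
  have m: "ideal ?m (ring_of_ints K)" by (rule ideal_ideal_pow[OF K pI'])
  note mD = idealD_ring_of_ints[OF m]
  note ray = mem_ray_subgroup_iff[OF K m I I0] and ring = mem_ring_subgroup_iff[OF K I I0]
  show ?thesis
  proof
    assume ?L
    then obtain \<alpha> \<beta> c where \<alpha>: "?I = pideal K \<alpha>" "\<alpha> - 1 \<in> ?m"
      and \<beta>: "?I = pideal K \<beta>" "\<beta> - of_int c \<in> pideal K (of_nat f)"
      unfolding ray ring by blast
    obtain u v where u: "u \<in> intring K" "\<alpha> = u * \<beta>"
        and v: "v \<in> intring K" "\<beta> = v * \<alpha>"
    proof -
      have "\<alpha> \<in> pideal K \<beta>" "\<beta> \<in> pideal K \<alpha>"
        using self_in_pideal[OF K, of \<alpha>] self_in_pideal[OF K, of \<beta>] \<alpha>(1) \<beta>(1)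
            by simp_all
      thus ?thesis using that unfolding pideal_eq by blast
    qed
    have "\<beta> \<noteq> 0"
    proof
      assume "\<beta> = 0"
      thus False using 3 \<beta>(1) by (auto simp: pideal_eq)
    qed
    moreover have "\<beta> = (u * v) * \<beta>" using u(2) v(2) by (metis mult.assoc mult.commute)
    ultimately have "u * v = 1" by simp
    hence "u = 1 \<or> u = - 1" using intring_units u(1) v(1) by blast
    hence "\<beta> - 1 \<in> ?m \<or> \<beta> + 1 \<in> ?m"
        using \<alpha>(2) u(2) mD(4)[of "- \<beta> - 1"] by (auto simp: add.commute)
    moreover obtain w where "w \<in> intring K" "\<beta> - of_int c = w * of_nat f"
        using \<beta>(2) by (auto simp: pideal_eq)
    hence "\<beta> = of_int c + of_nat f * w" by (simp add: algebra_simps)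
    hence "\<beta> \<in> quadratic_order K f"
        using \<open>w \<in> intring K\<close> by (auto simp: quadratic_order_def)
    ultimately show ?R using \<beta>(1) by blast
  next
    assume ?R
    then obtain \<alpha>
        where \<alpha>: "\<alpha> \<in> quadratic_order K f" "?I = pideal K \<alpha>" "\<alpha> - 1 \<in> ?m \<or> \<alpha> + 1 \<in> ?m" by blast
    have "?I \<in> ray_subgroup K ?m" unfolding ray
    \<comment> \<open>For the other sign the generator \<alpha> is replaced by its negative, which
      generates the same ideal.\<close>
    proof (cases "\<alpha> - 1 \<in> ?m")
      case False
      hence "- \<alpha> - 1 \<in> ?m" using \<alpha>(3) mD(4)[of "\<alpha> + 1"] by simp
      thus "\<exists>\<alpha>. ?I = pideal K \<alpha> \<and> \<alpha> - 1 \<in> ?m"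
          using \<alpha>(2) pideal_uminus[OF K] by metis
    qed (use \<alpha>(2) in blast)
    moreover have "?I \<in> ring_subgroup K f"
    proof -
      obtain a w where aw: "\<alpha> = of_int a + of_nat f * w" "w \<in> intring K"
        using \<alpha>(1) by (auto simp: quadratic_order_def)
      \<comment> \<open>\<open>g\<close> divides \<alpha>, and \<alpha> divides
        \<open>3 ^ k\<close>, so \<open>g\<close> is a divisor of \<open>3 ^ k\<close>; as it also
        divides \<open>f\<close>, which is prime to 3, it is a unit.\<close>
      define g where "g = gcd a (int f)"
      obtain a' f' where g: "a = g * a'" "int f = g * f'" unfolding g_def
          by (metis dvdE gcd_dvd1 gcd_dvd2)
      obtain z where z: "z \<in> intring K" "3 ^ k = z * \<alpha>"
          using 3 \<alpha>(2) by (auto simp: pideal_eq)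
      have "(of_nat f :: complex) = of_int (int f)" by simp
      hence "\<alpha> = of_int g * (of_int a' + of_int f' * w)"
        unfolding aw(1) g by (simp add: algebra_simps)
      hence "of_int (3 ^ k) = of_int g * (z * (of_int a' + of_int f' * w))" using z(2) by simp
      moreover have "z * (of_int a' + of_int f' * w) \<in> intring K"
        by (intro intring_closed[OF K] z aw)
      ultimately have "g dvd 3 ^ k" unfolding mem_intring_iff by (blast intro: complex_of_int_dvd)
      moreover have "coprime (3 ^ k) g"
        using coprime_3_f g(2) by simp
      ultimately have "is_unit g" by (metis coprime_common_divisor dvd_refl)
      hence "coprime a (int f)" by (simp add: g_def coprime_iff_gcd_eq_1)
      moreover have "\<alpha> - of_int a \<in> pideal K (of_nat f)" using aw by (auto simp: pideal_eq)
      ultimately show ?thesis unfolding ring using \<alpha>(2) by blast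
    qed
    ultimately show ?L by blast
  qed
qed

text \<open>Adding the conjugate cancels the square root and leaves the integer \<open>x - c\<close>
  in the square of \<open>p'\<close>, hence divisible by 9. A general \<open>c\<close> serves both
  signs.\<close>

lemma trace_mod_9:
  assumes "\<alpha> \<in> ideal_pow K p k" "k \<ge> 2" "\<alpha> = (of_int x + of_int y * csqrt (of_int (- d))) / 2"
    and "\<alpha> - of_int c \<in> ideal_pow K p' 2"
  shows "[x = c] (mod 9)"
proof -
  note mD = idealD_ring_of_ints[OF ideal_ideal_pow[OF K pI', of 2]]
  have "cnj \<alpha> \<in> ideal_pow K p' 2"
    using cnj_ideal_pow(1)[OF assms(1)] ideal_pow_antimono[OF K pI' assms(2)] by blast
  hence "(\<alpha> - of_int c) + cnj \<alpha> \<in> ideal_pow K p' 2" using mD(3) assms(4) by blast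
  moreover have "(\<alpha> - of_int c) + cnj \<alpha> = of_int (x - c)"
    unfolding assms(3) s_def[symmetric] by (simp add: cnj_s field_simps)
  ultimately have "3 ^ 2 dvd x - c" using int_in_ideal_pow[of "x - c" 2] by simp
  thus ?thesis by (simp add: cong_iff_dvd_diff)
qed

end

theorem theorem4:
  fixes d dK :: int and f n :: nat
    and K \<Omega> \<Sigma> p3 p3' :: "complex set"
    and \<tau> :: "complex \<Rightarrow> complex"
  assumes "d > 0"
    and "K = quadratic_field (- d)"
    and "imag_quadratic_disc K dK"
    and "f > 0"
    and "- d = dK * int f ^ 2"
    and "[- d = 1] (mod 3)"
    and "p3 \<in> nonzero_primes K" and "p3' \<in> nonzero_primes K"
    and "p3' = cnj ` p3"
    and "cgenideal (ring_of_ints K) 3 = ideal_prod (ring_of_ints K) p3 p3'"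
    and "is_ring_class_field K f \<Omega>"
    and "is_ray_class_field K (p3' [^]\<^bsub>ideals_set (ring_of_ints K)\<^esub> (2 :: nat)) \<Sigma>"
    and "is_artin_symbol K (compositum \<Sigma> \<Omega>) p3 \<tau>"
    and "group.ord (Gal K (compositum \<Sigma> \<Omega>)) \<tau> = n"
    and "n \<ge> 2"
  shows "is_arg_min (\<lambda>k. k)
    (\<lambda>k :: nat. k > 0 \<and>
      (\<exists>(x :: int) (y :: int) \<alpha>.
         \<alpha> = (of_int x + of_int y * csqrt (of_int (- d))) / 2 \<and>
         p3 [^]\<^bsub>ideals_set (ring_of_ints K)\<^esub> k = cgenideal (ring_of_ints K) \<alpha> \<and>
         \<alpha> \<in> quadratic_order K f \<and>
         ([x = 1] (mod 9) \<or> [x = -1] (mod 9)) \<and>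
         (\<alpha> - 1 \<in> p3' [^]\<^bsub>ideals_set (ring_of_ints K)\<^esub> (2 :: nat) \<or>
          \<alpha> + 1 \<in> p3' [^]\<^bsub>ideals_set (ring_of_ints K)\<^esub> (2 :: nat)))) n"
proof -
  interpret three_splits_order d K p3 p3' dK f
    using assms by unfold_locales (simp_all add: ideal_prod_ring_of_ints)
  let ?m = "ideal_pow K p3' 2" and ?L = "compositum \<Sigma> \<Omega>"
  have m: "ideal ?m (ring_of_ints K)" by (rule ideal_ideal_pow[OF K pI'])
  have fO: "ideal (pideal K (of_nat f)) (ring_of_ints K)"
      by (intro ideal_pideal[OF K] intring_closed[OF K])
  \<comment> \<open>The first power unfolds to the product of the unit ideal with \<open>p3\<close>,
    so the unit law is needed to return to \<open>p3\<close>.\<close>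
  have "comaximal K (ideal_pow K p3 1) ?m" by (rule comaximal_pow)
  moreover have "ideal_pow K p3 1 = p3"
    by (simp add: ideal_prod_CC_intring intring_closed[OF K] pD)
  ultimately have co_m: "comaximal K p3 ?m" by simp
  have co_f: "comaximal K p3 (pideal K (of_nat f))"
  proof -
    \<comment> \<open>As 3 lies in \<open>p3\<close>, a Bezout relation between 3 and
      \<open>f\<close> makes \<open>p3\<close> prime to the conductor.\<close>
    obtain a b where ab: "a * 3 + b * int f = 1"
      using bezout_int[of 3 "int f"] coprime_3_f by (auto simp: coprime_iff_gcd_eq_1)
    have "of_int a * 3 \<in> p3" by (rule pD(6)[OF intring_closed(7)[OF K] three_in(1)])
    moreover have "of_int b * of_nat f \<in> pideal K (of_nat f)"
      by (rule pideal_mult[OF K intring_closed(7)[OF K] self_in_pideal[OF K]])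
    moreover have "of_int a * 3 + of_int b * of_nat f = (of_int (a * 3 + b * int f) :: complex)" by simp
    ultimately show ?thesis unfolding ab comaximal_iff[OF K pI fO] by (metis of_int_1)
  qed
  have gal: "galois_extension K \<Sigma>" "galois_extension K \<Omega>"
    using assms(11,12)
        by (auto simp: is_ring_class_field_def is_ray_class_field_def class_field_def abelian_extension_def)
  have L: "subfield ?L CC" unfolding compositum_def by (rule subfield_CC_generate_field)
  have sub: "\<Sigma> \<subseteq> ?L" "\<Omega> \<subseteq> ?L"
      by (auto simp: compositum_def intro: generate_field.incl)
  have KL: "K \<subseteq> ?L" using gal(1) sub(1) by (auto simp: galois_extension_def)
  obtain P where P: "P \<in> primes_above K ?L p3" using primes_above_nonempty[OF L KL] .
  have pK: "p3 \<subseteq> K" using pD(1) by (auto simp: mem_intring_iff)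
  have \<tau>: "\<tau> \<in> carrier (Gal K ?L)" using assms(13) by (simp add: is_artin_symbol_def)
  obtain \<rho> where \<rho>: "is_artin_symbol K \<Sigma> p3 \<rho>"
    "\<And>k :: nat. \<rho> [^]\<^bsub>Gal K \<Sigma>\<^esub> k = \<one>\<^bsub>Gal K \<Sigma>\<^esub> \<longleftrightarrow> ideal_pow K p3 k \<in> ray_subgroup K ?m"
    using class_field_artin_pow[OF K m assms(12)[unfolded is_ray_class_field_def] p co_m] by blast
  obtain \<omega> where \<omega>: "is_artin_symbol K \<Omega> p3 \<omega>"
    "\<And>k :: nat. \<omega> [^]\<^bsub>Gal K \<Omega>\<^esub> k = \<one>\<^bsub>Gal K \<Omega>\<^esub> \<longleftrightarrow> ideal_pow K p3 k \<in> ring_subgroup K f"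
    using class_field_artin_pow[OF K fO assms(11)[unfolded is_ring_class_field_def] p co_f] by blast
  have "restrict \<tau> \<Sigma> = \<rho>"
    by (rule artin_symbol_restrict[OF L gal(1) sub(1) prime_p(2) pK P assms(13) \<rho>(1)])
  moreover have "restrict \<tau> \<Omega> = \<omega>"
    by (rule artin_symbol_restrict[OF L gal(2) sub(2) prime_p(2) pK P assms(13) \<omega>(1)])
  ultimately have pow: "\<tau> [^]\<^bsub>Gal K ?L\<^esub> k = \<one>\<^bsub>Gal K ?L\<^esub> \<longleftrightarrow>
    (\<exists>\<alpha>\<in>quadratic_order K f. ideal_pow K p3 k = pideal K \<alpha> \<and> (\<alpha> - 1 \<in> ?m \<or> \<alpha> + 1 \<in> ?m))" for k :: nat
    using compositum_Gal_pow_eq_one_iff[OF gal \<tau>, of k] \<rho>(2) \<omega>(2) ideal_pow_p_in_class_subgroups_iff[of k]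
    by simp
  have dvd: "\<tau> [^]\<^bsub>Gal K ?L\<^esub> k = \<one>\<^bsub>Gal K ?L\<^esub> \<longleftrightarrow> n dvd k" for k :: nat
    using group.pow_eq_id[OF group_Gal[OF L KL] \<tau>] assms(14) by simp
  \<comment> \<open>Such a generator forces the k-th power of \<tau> to be 1, so \<open>n\<close>
    divides the positive number \<open>k\<close>.\<close>
  have min: "\<not> k < n"
      if "k > 0" "\<alpha> \<in> quadratic_order K f" "ideal_pow K p3 k = pideal K \<alpha>"
    "\<alpha> - 1 \<in> ?m \<or> \<alpha> + 1 \<in> ?m" for k \<alpha>
    using pow[of k] dvd[of k] that by (auto dest: dvd_imp_le)
  obtain \<alpha> where \<alpha>: "\<alpha> \<in> quadratic_order K f" "ideal_pow K p3 n = pideal K \<alpha>" "\<alpha> - 1 \<in> ?m \<or> \<alpha> + 1 \<in> ?m"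
    using pow[of n] dvd[of n] by auto
  obtain x y :: int where xy: "\<alpha> = (of_int x + of_int y * csqrt (of_int (- d))) / 2"
    using quadratic_order_coords[OF \<alpha>(1)] .
  have "\<alpha> \<in> ideal_pow K p3 n" unfolding \<alpha>(2) by (rule self_in_pideal[OF K])
  \<comment> \<open>Here \<open>n \<ge> 2\<close> enters: the conjugate of \<alpha> lies in the n-th
    power of \<open>p3'\<close>, which is then contained in its square. The two instances of
    \<open>c\<close> match the two signs of \<alpha>.\<close>
  hence "[x = 1] (mod 9) \<or> [x = -1] (mod 9)"
    using trace_mod_9[OF _ assms(15) xy, of 1] trace_mod_9[OF _ assms(15) xy, of "-1"] \<alpha>(3)
        by auto
  thus ?thesis
    unfolding is_arg_min_def using assms(15) \<alpha> xy min by (intro conjI) (simp, blast, blast)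
qed

end
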